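(* For every positive integer $c$, \textsc{$c$-Closed Vertex Deletion} can be solved in $\mathcal{O}(n\cdot c)$ time when the input graph is a unit interval graph on $n$ vertices whose largest clique has at most $c+1$ vertices.
   Context: A unit interval graph is a graph whose vertices correspond to closed intervals of the real line of equal length, two vertices being adjacent iff their intervals intersect. A graph is $c$-closed if every pair of distinct nonadjacent vertices has at most $c-1$ common neighbors. \textsc{$c$-Closed Vertex Deletion}: given a graph $G=(V,E)$ and a positive integer $k$, decide whether there is $S\subseteq V$ with $|S|\le k$ such that $G-S$ is $c$-closed. *)

theory Defs
  imports Complex_Main
begin

section \<open>Graphs and the problem\<close>

record 'v ugraph =
  verts :: "'v set"
  edges :: "'v set set"

definition simple_graph :: "'v ugraph \<Rightarrow> bool" where
  "simple_graph G \<longleftrightarrow> finite (verts G) \<and>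
     edges G \<subseteq> {{u, v} | u v. u \<in> verts G \<and> v \<in> verts G \<and> u \<noteq> v}"

definition adj :: "'v ugraph \<Rightarrow> 'v \<Rightarrow> 'v \<Rightarrow> bool" where
  "adj G u v \<longleftrightarrow> {u, v} \<in> edges G"

definition unit_interval_graph :: "'v ugraph \<Rightarrow> bool" where
  "unit_interval_graph G \<longleftrightarrow> simple_graph G \<and>
     (\<exists>(a :: 'v \<Rightarrow> real) l. l > 0 \<and>
        (\<forall>u \<in> verts G. \<forall>v \<in> verts G. u \<noteq> v \<longrightarrow>
           (adj G u v \<longleftrightarrow> {a u .. a u + l} \<inter> {a v .. a v + l} \<noteq> {})))"

definition is_clique :: "'v ugraph \<Rightarrow> 'v set \<Rightarrow> bool" where
  "is_clique G K \<longleftrightarrow> K \<subseteq> verts G \<and> (\<forall>u \<in> K. \<forall>v \<in> K. u \<noteq> v \<longrightarrow> adj G u v)"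

definition clique_number :: "'v ugraph \<Rightarrow> nat" where
  "clique_number G = Max {card K | K. is_clique G K}"

definition common_neighbors :: "'v ugraph \<Rightarrow> 'v \<Rightarrow> 'v \<Rightarrow> 'v set" where
  "common_neighbors G u v = {w \<in> verts G. adj G u w \<and> adj G v w}"

text \<open>Only meaningful for \<open>c \<ge> 1\<close>, where the subtraction does not truncate.\<close>

definition c_closed :: "nat \<Rightarrow> 'v ugraph \<Rightarrow> bool" where
  "c_closed c G \<longleftrightarrow> (\<forall>u \<in> verts G. \<forall>v \<in> verts G.
     u \<noteq> v \<and> \<not> adj G u v \<longrightarrow> card (common_neighbors G u v) \<le> c - 1)"

definition delete_verts :: "'v ugraph \<Rightarrow> 'v set \<Rightarrow> 'v ugraph" where
  "delete_verts G S = \<lparr>verts = verts G - S, edges = {e \<in> edges G. e \<inter> S = {}}\<rparr>"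

definition c_closed_vertex_deletion :: "nat \<Rightarrow> 'v ugraph \<Rightarrow> nat \<Rightarrow> bool" where
  "c_closed_vertex_deletion c G k \<longleftrightarrow>
     (\<exists>S \<subseteq> verts G. card S \<le> k \<and> c_closed c (delete_verts G S))"


section \<open>Machine model\<close>

text \<open>
  Programs run on a random access machine with finitely many registers and arrays (those
  named in the program), addressed indirectly, and every elementary operation costs one unit.
  The only arithmetic is successor and predecessor (a successor RAM).  So in \<open>t\<close> units of
  time a program only produces numbers bounded by \<open>t\<close> plus the largest number in the input or
  the program text: unit cost cannot be exploited through huge numbers, and every operation is
  a constant number of operations of a RAM with logarithmic word length.
\<close>

datatype exp =
    Const nat
  | Reg string
  | Read string exp
  | Inc exp
  | Dec exp

datatype test =
    Less exp exp
  | Equal exp exp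
  | Neg test
  | Conj test test

datatype prog =
    Skip
  | Assign string exp
  | Write string exp exp
  | Seq prog prog
  | IfElse test prog prog
  | While test prog

record state =
  reg :: "string \<Rightarrow> nat"
  arr :: "string \<Rightarrow> nat \<Rightarrow> nat"

fun eval_exp :: "exp \<Rightarrow> state \<Rightarrow> nat" where
  "eval_exp (Const m) s = m"
| "eval_exp (Reg x) s = reg s x"
| "eval_exp (Read a e) s = arr s a (eval_exp e s)"
| "eval_exp (Inc e) s = eval_exp e s + 1"
| "eval_exp (Dec e) s = eval_exp e s - 1"

fun exp_cost :: "exp \<Rightarrow> nat" where
  "exp_cost (Const m) = 1"
| "exp_cost (Reg x) = 1"
| "exp_cost (Read a e) = 1 + exp_cost e"
| "exp_cost (Inc e) = 1 + exp_cost e"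
| "exp_cost (Dec e) = 1 + exp_cost e"

fun eval_test :: "test \<Rightarrow> state \<Rightarrow> bool" where
  "eval_test (Less e f) s \<longleftrightarrow> eval_exp e s < eval_exp f s"
| "eval_test (Equal e f) s \<longleftrightarrow> eval_exp e s = eval_exp f s"
| "eval_test (Neg b) s \<longleftrightarrow> \<not> eval_test b s"
| "eval_test (Conj b d) s \<longleftrightarrow> eval_test b s \<and> eval_test d s"

fun test_cost :: "test \<Rightarrow> nat" where
  "test_cost (Less e f) = 1 + exp_cost e + exp_cost f"
| "test_cost (Equal e f) = 1 + exp_cost e + exp_cost f"
| "test_cost (Neg b) = 1 + test_cost b"
| "test_cost (Conj b d) = 1 + test_cost b + test_cost d"

text \<open>\<open>exec p s t s'\<close>: started in \<open>s\<close>, program \<open>p\<close> halts in \<open>s'\<close> after exactly \<open>t\<close> units of time.\<close>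

inductive exec :: "prog \<Rightarrow> state \<Rightarrow> nat \<Rightarrow> state \<Rightarrow> bool" where
  exec_Skip: "exec Skip s 1 s"
| exec_Assign: "exec (Assign x e) s (1 + exp_cost e) (s\<lparr>reg := (reg s)(x := eval_exp e s)\<rparr>)"
| exec_Write: "exec (Write a e f) s (1 + exp_cost e + exp_cost f)
    (s\<lparr>arr := (arr s)(a := (arr s a)(eval_exp e s := eval_exp f s))\<rparr>)"
| exec_Seq: "exec p s t s' \<Longrightarrow> exec q s' t' s'' \<Longrightarrow> exec (Seq p q) s (t + t') s''"
| exec_If_True: "eval_test b s \<Longrightarrow> exec p s t s' \<Longrightarrow>
    exec (IfElse b p q) s (1 + test_cost b + t) s'"
| exec_If_False: "\<not> eval_test b s \<Longrightarrow> exec q s t s' \<Longrightarrow>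
    exec (IfElse b p q) s (1 + test_cost b + t) s'"
| exec_While_True: "eval_test b s \<Longrightarrow> exec p s t s' \<Longrightarrow> exec (While b p) s' t' s'' \<Longrightarrow>
    exec (While b p) s (1 + test_cost b + t + t') s''"
| exec_While_False: "\<not> eval_test b s \<Longrightarrow> exec (While b p) s (1 + test_cost b) s"

inductive_cases exec_SkipE: "exec Skip s t s'"
inductive_cases exec_AssignE: "exec (Assign x e) s t s'"
inductive_cases exec_WriteE: "exec (Write a e f) s t s'"
inductive_cases exec_SeqE: "exec (Seq p q) s t s'"
inductive_cases exec_IfE: "exec (IfElse b p q) s t s'"
inductive_cases exec_WhileE: "exec (While b p) s t s'"

lemma exec_deterministic:
  "exec p s t s' \<Longrightarrow> exec p s u s'' \<Longrightarrow> u = t \<and> s'' = s'"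
proof (induction arbitrary: u s'' rule: exec.induct)
  case (exec_Seq p s t s' q t' s2)
  from exec_Seq.prems obtain u1 s1 u2
    where "exec p s u1 s1" "exec q s1 u2 s''" "u = u1 + u2"
    by (rule exec_SeqE) metis
  with exec_Seq.IH show ?case by metis
next
  case (exec_If_True b s p t s' q)
  from exec_If_True.prems exec_If_True.hyps obtain u1
    where "exec p s u1 s''" "u = 1 + test_cost b + u1"
    by cases auto
  with exec_If_True.IH show ?case by metis
next
  case (exec_If_False b s q t s' p)
  from exec_If_False.prems exec_If_False.hyps obtain u1
    where "exec q s u1 s''" "u = 1 + test_cost b + u1"
    by cases auto
  with exec_If_False.IH show ?case by metis
next
  case (exec_While_True b s p t s' t' s2)
  from exec_While_True.prems exec_While_True.hyps obtain u1 s1 u2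
    where "exec p s u1 s1" "exec (While b p) s1 u2 s''" "u = 1 + test_cost b + u1 + u2"
    by cases auto
  with exec_While_True.IH show ?case by metis
next
  case (exec_While_False b s p)
  from exec_While_False.prems exec_While_False.hyps show ?case
    by cases auto
qed (auto elim: exec_SkipE exec_AssignE exec_WriteE)


section \<open>Input and output\<close>

text \<open>
  The vertices are numbered \<open>0, \<dots>, n - 1\<close>; entry \<open>u\<close> of \<open>L\<close> lists the neighbors of \<open>u\<close>, in
  arbitrary order and without repetition.
\<close>

definition adjacency_lists :: "nat ugraph \<Rightarrow> nat list list \<Rightarrow> bool" where
  "adjacency_lists G L \<longleftrightarrow> verts G = {..<length L} \<and>
     (\<forall>u < length L. distinct (L ! u) \<and> set (L ! u) = {v. adj G u v})"

text \<open>
  The lists are stored one after the other in \<open>tgt\<close>, list \<open>u\<close> occupying the positions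
  from \<open>off[u]\<close> up to but excluding \<open>off[u + 1]\<close>.  All other memory is initially zero.
\<close>

definition input_state :: "nat \<Rightarrow> nat \<Rightarrow> nat list list \<Rightarrow> state" where
  "input_state c k L =
     \<lparr>reg = (\<lambda>_. 0)(''n'' := length L, ''c'' := c, ''k'' := k),
      arr = (\<lambda>_ _. 0)
        (''off'' := (\<lambda>u. if u \<le> length L then length (concat (take u L)) else 0),
         ''tgt'' := (\<lambda>i. if i < length (concat L) then concat L ! i else 0))\<rparr>"

definition accepts :: "state \<Rightarrow> bool" where
  "accepts s \<longleftrightarrow> reg s ''out'' = 1"

end

(*
  In a unit interval graph with clique number at most c + 1, take the vertices in the order of
  their intervals.  A nonadjacent pair with c common neighbors consists of the ends of a window of
  c + 2 consecutive vertices in which the first c + 1 and the last c + 1 form cliques.  So deleting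
  vertices makes the graph c-closed iff it meets every such window, and as all windows have the
  same length, an optimal hitting set takes the last vertex of the first window not yet met,
  again and again.

  The order is computed by two passes of a breadth-first search that appends the unvisited
  neighbors of a queue entry by increasing degree.  In the first pass, started anywhere, the first
  child of the last entry that has children is an end vertex of its component, up to vertices with
  the same closed neighborhood.  Started from an end vertex, the search visits the component in
  interval order, again up to such twins: the unvisited neighbors of an entry have no neighbors
  to the left of it, so that their degrees order their right ends.  Finding the next child by
  scanning an adjacency list costs O(c), once for every vertex appended or exhausted.
*)

theory Submission
  imports Defs
begin

section \<open>Unit interval graphs and the search order\<close>

text \<open>The program never sees an interval: coordinates occur only in invariants, and adjacency
  lists cannot distinguish a representation from one with a component mirrored or with vertices of
  equal closed neighborhood exchanged. Hence order statements use \<open>prec\<close>, which ignores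
  such twins, and a sign chosen per component. Degrees can replace coordinates because the closed
  neighborhoods to be compared turn out to be nested: inclusion one way and degrees the other way
  force equality, so a vertex that its degree seems to misplace is a twin.

  From the geometry, the deletion argument takes only the \<open>umbrella\<close> property: right
  neighborhoods are runs of consecutive positions, so one number per position determines the graph.
  The clique bound is used twice: a vertex and its right neighbors form a clique, which limits the
  right degree to c, and counting both sides limits the degree to 2c, hence the length of every
  scan.

  The relation \<open>search_step\<close> leaves ties between equal degrees open, so the order is
  correct for every arrangement of the lists and the program only has to refine single
  steps.\<close>

definition cnbhd :: "('v \<Rightarrow> 'v set) \<Rightarrow> 'v \<Rightarrow> 'v set" where
  "cnbhd nb u = insert u (nb u)"

definition prec :: "('v \<Rightarrow> 'v set) \<Rightarrow> ('v \<Rightarrow> real) \<Rightarrow> 'v \<Rightarrow> 'v \<Rightarrow> bool" where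
  "prec nb a u v \<longleftrightarrow> a u \<le> a v \<or> cnbhd nb u = cnbhd nb v"

definition closed_under :: "('v \<Rightarrow> 'v set) \<Rightarrow> 'v set \<Rightarrow> bool" where
  "closed_under nb X \<longleftrightarrow> (\<forall>u\<in>X. nb u \<subseteq> X)"

definition reach :: "('v \<Rightarrow> 'v set) \<Rightarrow> 'v \<Rightarrow> 'v set" where
  "reach nb u = {(x, y). y \<in> nb x}\<^sup>* `` {u}"

text \<open>The ordering condition that characterizes proper, equivalently unit, interval
  graphs.\<close>

definition umbrella :: "('v \<Rightarrow> 'v set) \<Rightarrow> 'v list \<Rightarrow> bool" where
  "umbrella nb Q \<longleftrightarrow> (\<forall>x y z. x < y \<and> y < z \<and> z < length Q \<and> Q ! z \<in> nb (Q ! x) \<longrightarrow>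
     Q ! y \<in> nb (Q ! x) \<and> Q ! z \<in> nb (Q ! y))"

text \<open>The choice of \<open>b\<close> leaves open at which end of its component
  \<open>s\<close> lies; the search cannot tell left from right.\<close>

definition extreme :: "('v \<Rightarrow> 'v set) \<Rightarrow> ('v \<Rightarrow> real) \<Rightarrow> 'v \<Rightarrow> bool" where
  "extreme nb a s \<longleftrightarrow> (\<exists>b\<in>{a, \<lambda>u. - a u}. \<forall>w\<in>reach nb s. prec nb b s w)"

lemma reach_refl [simp]: "u \<in> reach nb u"
  by (simp add: reach_def)

lemma reach_step: "v \<in> reach nb u \<Longrightarrow> w \<in> nb v \<Longrightarrow> w \<in> reach nb u"
  unfolding reach_def by (auto intro: rtrancl.rtrancl_into_rtrancl)

lemma reach_subset_closed:
  assumes "closed_under nb X" "u \<in> X" shows "reach nb u \<subseteq> X"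
proof
  fix w assume "w \<in> reach nb u"
  then have "(u, w) \<in> {(x, y). y \<in> nb x}\<^sup>*" by (simp add: reach_def)
  then show "w \<in> X"
    by induction (use assms in \<open>auto simp: closed_under_def\<close>)
qed

lemma reach_trans: "v \<in> reach nb u \<Longrightarrow> w \<in> reach nb v \<Longrightarrow> w \<in> reach nb u"
  unfolding reach_def by auto

text \<open>A state consists of the number of start candidates consumed, the queue, the number of
  exhausted queue entries, whether the current queue entry already has a child, and for each
  connected component so far the first child of its last entry with children (initially, its
  start).\<close>

inductive search_step ::
  "('v \<Rightarrow> 'v set) \<Rightarrow> 'v list \<Rightarrow> nat \<times> 'v list \<times> nat \<times> bool \<times> 'v list \<Rightarrow>
    nat \<times> 'v list \<times> nat \<times> bool \<times> 'v list \<Rightarrow> bool"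
  for nb src where
  append: "h < length Q \<Longrightarrow> w \<in> nb (Q ! h) - set Q \<Longrightarrow>
    \<forall>v \<in> nb (Q ! h) - set Q. card (nb w) \<le> card (nb v) \<Longrightarrow>
    search_step nb src (i, Q, h, f, S) (i, Q @ [w], h, True, if f then S else butlast S @ [w])"
| advance: "h < length Q \<Longrightarrow> nb (Q ! h) \<subseteq> set Q \<Longrightarrow>
    search_step nb src (i, Q, h, f, S) (i, Q, Suc h, False, S)"
| skip: "h = length Q \<Longrightarrow> i < length src \<Longrightarrow> src ! i \<in> set Q \<Longrightarrow>
    search_step nb src (i, Q, h, f, S) (Suc i, Q, h, f, S)"
| start: "h = length Q \<Longrightarrow> i < length src \<Longrightarrow> src ! i \<notin> set Q \<Longrightarrow>
    search_step nb src (i, Q, h, f, S) (Suc i, Q @ [src ! i], h, False, S @ [src ! i])"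

section \<open>Comparing vertices by closed neighborhoods and degrees\<close>

locale unit_interval =
  fixes V :: "'v set" and nb :: "'v \<Rightarrow> 'v set" and a :: "'v \<Rightarrow> real" and l :: real
  assumes finite_V: "finite V" and l_pos: "0 < l"
    and nb_eq: "u \<in> V \<Longrightarrow> nb u = {v \<in> V. v \<noteq> u \<and> \<bar>a u - a v\<bar> \<le> l}"
begin

text \<open>Negated coordinates let one argument serve for both ends of a component and for both
  directions of the search.\<close>

lemma reflect: "unit_interval V nb (\<lambda>u. - a u) l"
  using finite_V l_pos nb_eq by unfold_locales (auto simp: abs_if)

lemma in_nb: "u \<in> V \<Longrightarrow> v \<in> nb u \<longleftrightarrow> v \<in> V \<and> v \<noteq> u \<and> \<bar>a u - a v\<bar> \<le> l"
  using nb_eq by blast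

lemma nb_subset: "u \<in> V \<Longrightarrow> nb u \<subseteq> V"
  using in_nb by blast

lemma nb_sym: "u \<in> V \<Longrightarrow> v \<in> nb u \<Longrightarrow> u \<in> nb v"
  by (metis in_nb abs_minus_commute)

lemma in_cnbhd: "u \<in> V \<Longrightarrow> v \<in> cnbhd nb u \<longleftrightarrow> v \<in> V \<and> \<bar>a u - a v\<bar> \<le> l"
  using in_nb[of u v] l_pos by (auto simp: cnbhd_def)

lemma card_cnbhd:
  assumes "u \<in> V" shows "card (cnbhd nb u) = Suc (card (nb u))"
proof -
  have "u \<notin> nb u" using in_nb assms by blast
  moreover have "finite (nb u)" using nb_subset[OF assms] finite_V by (rule finite_subset)
  ultimately show ?thesis by (simp add: cnbhd_def)
qed

text \<open>This turns a comparison of degrees into a statement about twins: an inclusion without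
  loss in size is an equality.\<close>

lemma cnbhd_eqI:
  assumes "u \<in> V" "v \<in> V" "cnbhd nb u \<subseteq> cnbhd nb v" "card (nb v) \<le> card (nb u)"
  shows "cnbhd nb u = cnbhd nb v"
proof (rule card_subset_eq)
  show "finite (cnbhd nb v)"
    using finite_V nb_subset[OF assms(2)] by (auto simp: cnbhd_def intro: finite_subset)
  then show "card (cnbhd nb u) = card (cnbhd nb v)"
    using assms card_cnbhd card_mono[OF _ assms(3)] by (metis le_antisym Suc_le_mono)
qed (fact assms)

lemma prec_refl: "prec nb a u u"
  by (simp add: prec_def)

text \<open>Suppose \<open>w\<close> lies to the right of \<open>w'\<close>. Up to twins of the
  parent \<open>p\<close>, no neighbor of \<open>w'\<close> is left of \<open>p\<close>, so it is at
  most \<open>l\<close> to the left of \<open>w\<close>; and it is at most \<open>l\<close> to the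
  right of \<open>w'\<close>, hence of \<open>w\<close>. So the closed neighborhood of
  \<open>w'\<close> is contained in that of \<open>w\<close>, and the degrees make them
  twins.\<close>

lemma prec_sibling:
  assumes "p \<in> V" "w \<in> nb p" "w' \<in> nb p" "card (nb w) \<le> card (nb w')"
    and "\<And>z. z \<in> cnbhd nb w' \<Longrightarrow> prec nb a p z"
  shows "prec nb a w w'"
proof (cases "a w \<le> a w'")
  case False
  have V: "w \<in> V" "w' \<in> V" using assms nb_subset by auto
  have "cnbhd nb w' \<subseteq> cnbhd nb w"
  proof
    fix z assume z: "z \<in> cnbhd nb w'"
    then have zV: "z \<in> V" "\<bar>a w' - a z\<bar> \<le> l" using in_cnbhd V by auto
    have wp: "\<bar>a p - a w\<bar> \<le> l" using assms in_nb by blast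
    from assms(5)[OF z] consider "a p \<le> a z" | "cnbhd nb p = cnbhd nb z"
      by (auto simp: prec_def)
    then show "z \<in> cnbhd nb w"
    proof cases
      case 1
      then show ?thesis using False zV wp in_cnbhd[OF V(1)] by auto
    next
      case 2
      then have "w \<in> cnbhd nb z" using assms(2) by (auto simp: cnbhd_def)
      then show ?thesis using zV V in_cnbhd[OF V(1)] in_cnbhd[OF zV(1)] by (simp add: abs_minus_commute)
    qed
  qed
  then show ?thesis using cnbhd_eqI[OF V(2,1)] assms(4) by (simp add: prec_def)
qed (simp add: prec_def)

text \<open>The vertex \<open>w'\<close> lies more than \<open>l\<close> to the right of
  \<open>p\<close>, and \<open>w\<close> at most \<open>l\<close>.\<close>

lemma prec_non_neighbour:
  assumes "p \<in> V" "w \<in> nb p" "w' \<in> V" "w' \<notin> cnbhd nb p" "prec nb a p w'"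
  shows "prec nb a w w'"
proof -
  have "cnbhd nb p \<noteq> cnbhd nb w'" using assms by (auto simp: cnbhd_def)
  then have "a p \<le> a w'" using assms by (auto simp: prec_def)
  moreover have "\<bar>a p - a w\<bar> \<le> l" using assms in_nb by blast
  moreover have "\<not> \<bar>a p - a w'\<bar> \<le> l" using assms in_cnbhd by auto
  ultimately show ?thesis by (auto simp: prec_def)
qed

text \<open>Without twins the three coordinates are in order and the middle vertex is closer to both
  ends than they are to each other. Twins pass the adjacency on directly.\<close>

lemma prec_umbrella:
  assumes V: "x \<in> V" "y \<in> V" "z \<in> V" and d: "x \<noteq> y" "y \<noteq> z"
    and p: "prec nb a x y" "prec nb a y z" and n: "z \<in> nb x"
  shows "y \<in> nb x \<and> z \<in> nb y"
proof -
  have zx: "z \<noteq> x" "\<bar>a x - a z\<bar> \<le> l" using n V in_nb by blast+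
  have "y \<in> cnbhd nb x \<and> z \<in> cnbhd nb y"
  proof (cases "cnbhd nb x = cnbhd nb y \<or> cnbhd nb y = cnbhd nb z")
    case True
    then show ?thesis
      using in_cnbhd V zx by (metis abs_minus_commute cnbhd_def insertI1 n insertI2)
  next
    case False
    then have "a x \<le> a y" "a y \<le> a z" using p by (auto simp: prec_def)
    then show ?thesis using zx V in_cnbhd by auto
  qed
  then show ?thesis using d by (auto simp: cnbhd_def)
qed

section \<open>Convex visited sets and the ends of a component\<close>

text \<open>The condition \<open>a u < a w\<close> exempts singletons, which need not contain the other
  vertices at the same point.\<close>

definition convex_set :: "'v set \<Rightarrow> bool" where
  "convex_set B \<longleftrightarrow>
     (\<forall>u\<in>B. \<forall>w\<in>B. \<forall>z\<in>V. a u < a w \<and> a u \<le> a z \<and> a z \<le> a w \<longrightarrow> z \<in> B)"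

lemma convex_set_singleton: "convex_set {v}"
  by (auto simp: convex_set_def)

text \<open>The closed neighborhood of \<open>p\<close> is everything within \<open>l\<close> of
  \<open>p\<close>. Let \<open>z\<close> outside it lie between two members. On its side of
  \<open>p\<close>, the member beyond \<open>z\<close> is outside as well and so belongs to
  \<open>B\<close>; convexity of \<open>B\<close> between \<open>p\<close> and that member gives
  \<open>z\<close>.\<close>

lemma convex_set_Un_cnbhd:
  assumes "convex_set B" "p \<in> B" "p \<in> V"
  shows "convex_set (B \<union> cnbhd nb p)"
  unfolding convex_set_def
proof (intro ballI impI)
  fix u w z
  assume u: "u \<in> B \<union> cnbhd nb p" and w: "w \<in> B \<union> cnbhd nb p" and z: "z \<in> V"
    and zz: "a u < a w \<and> a u \<le> a z \<and> a z \<le> a w"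
  show "z \<in> B \<union> cnbhd nb p"
  proof (cases "z \<in> cnbhd nb p")
    case False
    then have far: "\<not> \<bar>a p - a z\<bar> \<le> l" using z in_cnbhd[OF assms(3)] by blast
    have ex: "z \<in> B" if "x \<in> B" "y \<in> B" "a x < a y" "a x \<le> a z" "a z \<le> a y" for x y
      using assms(1) that z unfolding convex_set_def by blast
    show ?thesis
    proof (cases "a p < a z")
      case True
      then have "\<not> \<bar>a p - a w\<bar> \<le> l" using far zz by linarith
      then have "w \<in> B" using w in_cnbhd[OF assms(3)] by blast
      then have "z \<in> B" using ex[of p w] assms(2) zz True by linarith
      then show ?thesis ..
    next
      case F: False
      then have "\<not> \<bar>a p - a u\<bar> \<le> l" using far zz by linarith
      then have "u \<in> B" using u in_cnbhd[OF assms(3)] by blast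
      moreover have "a z \<noteq> a p" using far l_pos by auto
      ultimately have "z \<in> B" using ex[of u p] assms(2) zz F by linarith
      then show ?thesis ..
    qed
  qed simp
qed

text \<open>In the application, \<open>C\<close> is a component, \<open>B\<close> the part visited
  before the children of its last parent \<open>p\<close>, and \<open>s\<close> the first of these
  children. A vertex \<open>w\<close> left of \<open>s\<close> is not in \<open>B\<close>, since
  \<open>B\<close> would contain everything between \<open>w\<close> and \<open>p\<close>, hence
  \<open>s\<close>. Neighbors of \<open>w\<close> at or right of \<open>s\<close> are within
  \<open>l\<close> of \<open>s\<close>; those left of \<open>s\<close> are outside \<open>B\<close>,
  hence neighbors of \<open>p\<close>, and again within \<open>l\<close> of \<open>s\<close>. So
  \<open>w\<close> has a closed neighborhood inside that of \<open>s\<close> but no smaller degree,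
  and is a twin.\<close>

lemma prec_last_children:
  assumes "C \<subseteq> V" "closed_under nb C" "B \<subseteq> C" "convex_set B" "p \<in> B" "s \<in> C - B"
    "C - B \<subseteq> nb p" "\<And>w. w \<in> C - B \<Longrightarrow> card (nb s) \<le> card (nb w)"
    and sp: "a s \<le> a p" and w: "w \<in> C"
  shows "prec nb a s w"
proof (cases "a s \<le> a w")
  case False
  have pV: "p \<in> V" and sV: "s \<in> V" using assms(1,3,5,6) by auto
  have low: "x \<in> C - B" if "x \<in> C" "a x < a s" for x
  proof -
    have "x \<in> B \<Longrightarrow> s \<in> B"
      using assms(4,5) sp sV that(2) order_less_le_trans[OF that(2) sp] less_imp_le[OF that(2)]
      unfolding convex_set_def by blast
    then show ?thesis using that(1) assms(6) by blast
  qed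
  have wV: "w \<in> V" using w assms(1) by auto
  have "cnbhd nb w \<subseteq> cnbhd nb s"
  proof
    fix z assume "z \<in> cnbhd nb w"
    then have z: "z \<in> C" "z \<in> V" "\<bar>a w - a z\<bar> \<le> l"
      using w assms(2) in_cnbhd[OF wV] unfolding closed_under_def cnbhd_def by blast+
    show "z \<in> cnbhd nb s"
    proof (cases "a s \<le> a z")
      case True
      then show ?thesis using z False in_cnbhd[OF sV] by auto
    next
      case F: False
      then have "z \<in> nb p" using low[of z] z(1) assms(7) by force
      then have "\<bar>a p - a z\<bar> \<le> l" using in_nb[OF pV] by blast
      then show ?thesis using z F sp in_cnbhd[OF sV] by auto
    qed
  qed
  moreover have "card (nb s) \<le> card (nb w)" using assms(8) low[of w] False w by simp
  ultimately show ?thesis using cnbhd_eqI[OF wV sV] by (simp add: prec_def)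
qed (simp add: prec_def)

interpretation R: unit_interval V nb "\<lambda>u. - a u" l
  by (rule reflect)

lemma convex_set_reflect: "R.convex_set B \<longleftrightarrow> convex_set B"
proof -
  have "R.convex_set B \<longleftrightarrow>
      (\<forall>u\<in>B. \<forall>w\<in>B. \<forall>z\<in>V. a w < a u \<and> a z \<le> a u \<and> a w \<le> a z \<longrightarrow> z \<in> B)"
    by (simp add: R.convex_set_def)
  then show ?thesis unfolding convex_set_def by blast
qed

text \<open>The first child lies on one side of its parent or on the other, and the second case is
  the first one mirrored.\<close>

lemma extreme_last_children:
  assumes "C \<subseteq> V" "closed_under nb C" "B \<subseteq> C" "convex_set B" "p \<in> B" "s \<in> C - B"
    "C - B \<subseteq> nb p" "\<And>w. w \<in> C - B \<Longrightarrow> card (nb s) \<le> card (nb w)"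
  shows "extreme nb a s"
proof -
  have sub: "reach nb s \<subseteq> C" using reach_subset_closed[OF assms(2)] assms(6) by simp
  show ?thesis
  proof (cases "a s \<le> a p")
    case True
    then have "prec nb a s w" if "w \<in> C" for w
      using prec_last_children[OF assms] that by blast
    then show ?thesis using sub by (auto simp: extreme_def)
  next
    case False
    then have "prec nb (\<lambda>u. - a u) s w" if "w \<in> C" for w
      using R.prec_last_children[OF assms(1-3) _ assms(5-8)] convex_set_reflect assms(4) that
      by auto
    then show ?thesis using sub by (auto simp: extreme_def)
  qed
qed

section \<open>Components and the bookkeeping common to both passes\<close>

lemma reach_sym:
  assumes "u \<in> V" "v \<in> reach nb u" shows "u \<in> reach nb v"
proof -
  have "(u, v) \<in> {(x, y). y \<in> nb x}\<^sup>*" using assms by (simp add: reach_def)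
  then have "v \<in> V \<and> (v, u) \<in> {(x, y). y \<in> nb x}\<^sup>*"
  proof induction
    case (step y z)
    then have "y \<in> nb z" "z \<in> V" using nb_sym nb_subset by auto
    then show ?case using step by (auto intro: converse_rtrancl_into_rtrancl)
  qed (use assms in simp)
  then show ?thesis by (simp add: reach_def)
qed

lemma closed_under_disjoint:
  assumes "closed_under nb X" "u \<in> V" "u \<notin> X" shows "nb u \<inter> X = {}"
  using assms nb_sym unfolding closed_under_def by blast

definition search_inv :: "'v list \<Rightarrow> nat \<times> 'v list \<times> nat \<times> bool \<times> 'v list \<Rightarrow> bool" where
  "search_inv src = (\<lambda>(i, Q, h, f, S). distinct Q \<and> set Q \<subseteq> V \<and> h \<le> length Q \<and>
     (\<forall>x<h. nb (Q ! x) \<subseteq> set Q) \<and> i \<le> length src \<and> set (take i src) \<subseteq> set Q)"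

lemma search_inv_step:
  assumes "search_step nb src x y" "search_inv src x" "set src \<subseteq> V"
  shows "search_inv src y"
  using assms
proof (induction rule: search_step.induct)
  case (append h Q w i f S)
  moreover from this have "Q ! h \<in> V" by (auto simp: search_inv_def)
  ultimately show ?case using nb_subset[of "Q ! h"]
    by (auto simp: search_inv_def nth_append)
next
  case (advance h Q i f S)
  then show ?case by (auto simp: search_inv_def less_Suc_eq)
next
  case (skip h Q i f S)
  then show ?case by (auto simp: search_inv_def take_Suc_conv_app_nth)
next
  case (start h Q i f S)
  then have "src ! i \<in> V" using nth_mem by blast
  with start show ?case by (auto simp: search_inv_def take_Suc_conv_app_nth nth_append)
qed

lemma search_inv_closed:
  "search_inv src (i, Q, h, f, S) \<Longrightarrow> h = length Q \<Longrightarrow> closed_under nb (set Q)"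
  unfolding search_inv_def closed_under_def by (metis (mono_tags, lifting) in_set_conv_nth old.prod.case)

section \<open>First pass: an end vertex of every component\<close>

definition last_children :: "'v list \<Rightarrow> 'v \<Rightarrow> bool \<Rightarrow> 'v \<Rightarrow> bool" where
  "last_children Q1 p f s \<longleftrightarrow>
    (Q1 = [s] \<and> \<not> f) \<or>
    (\<exists>B A q. Q1 = B @ A \<and> A \<noteq> [] \<and> q \<in> set B \<and> s = hd A \<and> (f \<longrightarrow> q = p) \<and>
       convex_set (set B) \<and> set A \<subseteq> nb q \<and>
       (\<forall>w\<in>nb q - set B. card (nb s) \<le> card (nb w)))"

text \<open>\<open>Q0\<close> and \<open>S0\<close> belong to finished components, \<open>Q1\<close>
  and \<open>S1\<close> to the current one. Children come by degree and from both sides of their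
  parent, so \<open>Q1\<close> need not be convex while the current entry is collecting them; during
  that time \<open>last_children\<close> keeps convexity for the part \<open>B\<close> that precedes
  the block \<open>A\<close> of children.\<close>

definition start_inv :: "nat \<times> 'v list \<times> nat \<times> bool \<times> 'v list \<Rightarrow> bool" where
  "start_inv = (\<lambda>(i, Q, h, f, S). \<exists>Q0 Q1 S0 S1. Q = Q0 @ Q1 \<and> S = S0 @ S1 \<and> length Q0 \<le> h \<and>
     closed_under nb (set Q0) \<and> (\<forall>s\<in>set S0. extreme nb a s) \<and> set S \<subseteq> set Q \<and>
     (\<forall>w\<in>set Q0. \<exists>s\<in>set S0. w \<in> reach nb s) \<and>
     (Q1 = [] \<and> S1 = [] \<or>
      (\<exists>s. S1 = [s] \<and> s \<in> set Q1 \<and> (\<forall>w\<in>set Q1. w \<in> reach nb (hd Q1)) \<and>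
       (\<not> f \<longrightarrow> convex_set (set Q1)) \<and> last_children Q1 (Q ! h) f s)))"

text \<open>With the queue exhausted, \<open>Q1\<close> is a whole component and \<open>A\<close> is
  its part outside \<open>B\<close>, the situation of \<open>extreme_last_children\<close>. A
  component in which no entry had a child is a single vertex.\<close>

lemma start_inv_complete:
  assumes "start_inv (i, Q, h, f, S)" "search_inv src (i, Q, h, f, S)" "h = length Q"
  shows "\<forall>s\<in>set S. extreme nb a s" "\<forall>w\<in>set Q. \<exists>s\<in>set S. w \<in> reach nb s" "set S \<subseteq> set Q"
proof -
  obtain Q0 Q1 S0 S1 where Q: "Q = Q0 @ Q1" "S = S0 @ S1" "closed_under nb (set Q0)"
    and e: "\<forall>s\<in>set S0. extreme nb a s" and cov: "\<forall>w\<in>set Q0. \<exists>s\<in>set S0. w \<in> reach nb s"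
    and d: "Q1 = [] \<and> S1 = [] \<or>
      (\<exists>s. S1 = [s] \<and> s \<in> set Q1 \<and> (\<forall>w\<in>set Q1. w \<in> reach nb (hd Q1)) \<and>
       (\<not> f \<longrightarrow> convex_set (set Q1)) \<and> last_children Q1 (Q ! h) f s)" and S: "set S \<subseteq> set Q"
    using assms(1) unfolding start_inv_def prod.case by blast
  show "set S \<subseteq> set Q" by (fact S)
  have clQ: "closed_under nb (set Q)" using assms search_inv_closed by blast
  have V: "set Q \<subseteq> V" "distinct Q" using assms unfolding search_inv_def by auto
  have cl1: "closed_under nb (set Q1)"
    using clQ closed_under_disjoint[OF Q(3)] V Q(1) unfolding closed_under_def by fastforce
  have "(\<forall>s\<in>set S. extreme nb a s) \<and> (\<forall>w\<in>set Q. \<exists>s\<in>set S. w \<in> reach nb s)"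
    using d
  proof (elim disjE exE conjE)
    fix s
    assume s: "S1 = [s]" "s \<in> set Q1" "\<forall>w\<in>set Q1. w \<in> reach nb (hd Q1)"
      "last_children Q1 (Q ! h) f s"
    have hd: "hd Q1 \<in> V" using V Q s by (cases Q1) auto
    have rs: "w \<in> reach nb s" if "w \<in> set Q1" for w
      using that s reach_sym[OF hd] reach_trans by metis
    have "extreme nb a s"
      using s(4) unfolding last_children_def
    proof (elim disjE exE conjE)
      assume "Q1 = [s]"
      then have "reach nb s \<subseteq> {s}" using cl1 reach_subset_closed[of nb "{s}" s] by auto
      then show ?thesis by (auto simp: extreme_def prec_def)
    next
      fix B A q
      assume A: "Q1 = B @ A" "A \<noteq> []" "q \<in> set B" "s = hd A"
       "convex_set (set B)" "set A \<subseteq> nb q"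
       "\<forall>w\<in>nb q - set B. card (nb s) \<le> card (nb w)"
      have dis: "set Q1 - set B = set A" using V Q A by auto
      show ?thesis
        by (rule extreme_last_children[of "set Q1" "set B" q])
          (use A dis V Q cl1 in \<open>auto\<close>)
    qed
    then show ?thesis using e cov rs s(1) Q by auto
  qed (use e cov Q in auto)
  then show "\<forall>s\<in>set S. extreme nb a s" "\<forall>w\<in>set Q. \<exists>s\<in>set S. w \<in> reach nb s" by auto
qed

text \<open>An appended vertex either opens a new block of children, with all of \<open>Q1\<close>
  as \<open>B\<close>, or extends the block of the current entry. On advancing past a parent, the
  visited part of the component is \<open>B\<close> together with the closed neighborhood of that
  parent, so convexity returns.\<close>

lemma start_inv_step:
  assumes "search_step nb src x y" "search_inv src x" "start_inv x"
  shows "start_inv y"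
  using assms
proof (induction rule: search_step.induct)
  case (append h Q w i f S)
  obtain Q0 Q1 S0 S1 where Q: "Q = Q0 @ Q1" "S = S0 @ S1" "closed_under nb (set Q0)"
    "length Q0 \<le> h"
    and e: "\<forall>s\<in>set S0. extreme nb a s" and cov: "\<forall>w\<in>set Q0. \<exists>s\<in>set S0. w \<in> reach nb s"
    and d: "Q1 = [] \<and> S1 = [] \<or>
      (\<exists>s. S1 = [s] \<and> s \<in> set Q1 \<and> (\<forall>w\<in>set Q1. w \<in> reach nb (hd Q1)) \<and>
       (\<not> f \<longrightarrow> convex_set (set Q1)) \<and> last_children Q1 (Q ! h) f s)" and S: "set S \<subseteq> set Q"
    using append(5) unfolding start_inv_def prod.case by blast
  have V: "set Q \<subseteq> V" "distinct Q" using append unfolding search_inv_def by auto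
  have p1: "Q ! h \<in> set Q1" using append(1) Q by (auto simp: nth_append)
  then obtain s where s: "S1 = [s]" "s \<in> set Q1" "\<forall>w\<in>set Q1. w \<in> reach nb (hd Q1)"
    "\<not> f \<longrightarrow> convex_set (set Q1)" "last_children Q1 (Q ! h) f s" using d by auto
  have ne: "Q1 \<noteq> []" using p1 by auto
  have wr: "w \<in> reach nb (hd Q1)" using s p1 append(2) reach_step by (metis DiffD1)
  \<comment> \<open>Finished components contain no neighbor of the current entry, so a minimum over
    its unvisited neighbors is one over its neighbors outside \<open>Q1\<close>.\<close>
  have dis: "nb (Q ! h) \<inter> set Q0 = {}"
    by (rule closed_under_disjoint) (use Q V p1 in auto)
  have eqp: "(Q @ [w]) ! h = Q ! h" using append(1) by (simp add: nth_append)
  define s' where "s' = (if f then s else w)"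
  have "last_children (Q1 @ [w]) (Q ! h) True s'"
  proof (cases f)
    case False
    show ?thesis unfolding last_children_def
      by (rule disjI2, rule exI[of _ Q1], rule exI[of _ "[w]"], rule exI[of _ "Q ! h"])
        (use False append p1 Q s dis in \<open>auto simp: s'_def\<close>)
  next
    case True
    then obtain B A where A: "Q1 = B @ A" "A \<noteq> []" "Q ! h \<in> set B" "s = hd A"
       "convex_set (set B)" "set A \<subseteq> nb (Q ! h)"
       "\<forall>w\<in>nb (Q ! h) - set B. card (nb s) \<le> card (nb w)"
      using s(5) by (auto simp: last_children_def)
    show ?thesis unfolding last_children_def
      by (rule disjI2, rule exI[of _ B], rule exI[of _ "A @ [w]"], rule exI[of _ "Q ! h"])
        (use True A append in \<open>auto simp: s'_def\<close>)
  qed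
  moreover have "(if f then S else butlast S @ [w]) = S0 @ [s']"
    using Q(2) s(1) by (simp add: s'_def butlast_append)
  moreover have "s' \<in> set (Q1 @ [w])" using s by (simp add: s'_def)
  moreover have "\<forall>v\<in>set (Q1 @ [w]). v \<in> reach nb (hd (Q1 @ [w]))" using s(3) wr ne by simp
  ultimately show ?case
    unfolding start_inv_def prod.case eqp
    by - (rule exI[of _ Q0], rule exI[of _ "Q1 @ [w]"], rule exI[of _ S0], rule exI[of _ "[s']"],
      use Q e cov S in auto)
next
  case (advance h Q i f S)
  obtain Q0 Q1 S0 S1 where Q: "Q = Q0 @ Q1" "S = S0 @ S1" "closed_under nb (set Q0)"
    "length Q0 \<le> h"
    and e: "\<forall>s\<in>set S0. extreme nb a s" and cov: "\<forall>w\<in>set Q0. \<exists>s\<in>set S0. w \<in> reach nb s"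
    and d: "Q1 = [] \<and> S1 = [] \<or>
      (\<exists>s. S1 = [s] \<and> s \<in> set Q1 \<and> (\<forall>w\<in>set Q1. w \<in> reach nb (hd Q1)) \<and>
       (\<not> f \<longrightarrow> convex_set (set Q1)) \<and> last_children Q1 (Q ! h) f s)" and S: "set S \<subseteq> set Q"
    using advance(4) unfolding start_inv_def prod.case by blast
  have V: "set Q \<subseteq> V" "distinct Q" using advance unfolding search_inv_def by auto
  have p1: "Q ! h \<in> set Q1" using advance(1) Q by (auto simp: nth_append)
  then obtain s where s: "S1 = [s]" "s \<in> set Q1" "\<forall>w\<in>set Q1. w \<in> reach nb (hd Q1)"
    "\<not> f \<longrightarrow> convex_set (set Q1)" "last_children Q1 (Q ! h) f s" using d by auto
  have dis: "nb (Q ! h) \<inter> set Q0 = {}"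
    by (rule closed_under_disjoint) (use Q V p1 in auto)
  have cv: "convex_set (set Q1)"
  proof (cases f)
    case True
    then obtain B A where A: "Q1 = B @ A" "A \<noteq> []" "Q ! h \<in> set B"
       "convex_set (set B)" "set A \<subseteq> nb (Q ! h)"
      using s(5) by (auto simp: last_children_def)
    have "set Q1 = set B \<union> cnbhd nb (Q ! h)"
      using A advance(2) dis Q(1) p1 by (auto simp: cnbhd_def)
    then show ?thesis using convex_set_Un_cnbhd[of "set B" "Q ! h"] A V p1 Q by auto
  qed (use s in simp)
  have "last_children Q1 (Q ! Suc h) False s"
    using s(5) unfolding last_children_def by auto
  then show ?case using Q s e cov S cv unfolding start_inv_def prod.case
    by - (rule exI[of _ Q0], rule exI[of _ Q1], rule exI[of _ S0], rule exI[of _ S1], auto)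
next
  case (skip h Q i f S)
  then show ?case by (simp add: start_inv_def)
next
  case (start h Q i f S)
  have SS: "\<forall>s\<in>set S. extreme nb a s" "\<forall>w\<in>set Q. \<exists>s\<in>set S. w \<in> reach nb s" "set S \<subseteq> set Q"
    by (rule start_inv_complete[OF start(5,4,1)])+
  have cl: "closed_under nb (set Q)" by (rule search_inv_closed[OF start(4,1)])
  have lc: "last_children [src ! i] p False (src ! i)" for p
    unfolding last_children_def by blast
  show ?case unfolding start_inv_def prod.case
    by (rule exI[of _ Q], rule exI[of _ "[src ! i]"], rule exI[of _ S],
        rule exI[of _ "[src ! i]"]) (use start(1) SS cl lc in \<open>simp add: convex_set_singleton subset_insertI2\<close>)
qed

section \<open>Second pass: each component in interval order\<close>

definition order_inv :: "nat \<times> 'v list \<times> nat \<times> bool \<times> 'v list \<Rightarrow> bool" where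
  "order_inv = (\<lambda>(i, Q, h, f, S). \<exists>Q0 Q1 r b. Q = Q0 @ Q1 \<and> length Q0 \<le> h \<and>
     closed_under nb (set Q0) \<and> umbrella nb Q0 \<and> b \<in> {a, \<lambda>u. - a u} \<and> (Q1 \<noteq> [] \<longrightarrow> r \<in> V) \<and>
     set Q1 \<subseteq> reach nb r \<and> sorted_wrt (prec nb b) Q1 \<and>
     (\<forall>x\<in>set Q1. \<forall>w\<in>reach nb r - set Q. prec nb b x w))"

lemma unit_interval_signed: "b \<in> {a, \<lambda>u. - a u} \<Longrightarrow> unit_interval V nb b l"
  using unit_interval_axioms reflect by auto

text \<open>The direction \<open>b\<close> belongs to the current component; of earlier ones only
  the umbrella property is kept. They are closed under neighbors, so an edge that starts in
  \<open>Q0\<close> ends there, and no triple compares vertices across components.\<close>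

lemma order_inv_umbrella:
  assumes "order_inv (i, Q, h, f, S)" "search_inv src (i, Q, h, f, S)"
  shows "umbrella nb Q"
proof -
  obtain Q0 Q1 b where Q: "Q = Q0 @ Q1" "closed_under nb (set Q0)" "umbrella nb Q0"
    "b \<in> {a, \<lambda>u. - a u}" "sorted_wrt (prec nb b) Q1"
    using assms(1) unfolding order_inv_def prod.case by blast
  interpret B: unit_interval V nb b l using unit_interval_signed[OF Q(4)] .
  have V: "set Q \<subseteq> V" "distinct Q" using assms unfolding search_inv_def by auto
  show ?thesis unfolding umbrella_def
  proof (intro allI impI)
    fix x y z assume xyz: "x < y \<and> y < z \<and> z < length Q \<and> Q ! z \<in> nb (Q ! x)"
    show "Q ! y \<in> nb (Q ! x) \<and> Q ! z \<in> nb (Q ! y)"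
    proof (cases "x < length Q0")
      case True
      then have "Q ! x \<in> set Q0" using Q(1) by (simp add: nth_append)
      then have "Q ! z \<in> set Q0" using Q(2) xyz unfolding closed_under_def by blast
      moreover have "Q ! z \<in> set Q1" if "\<not> z < length Q0"
        using that xyz Q(1) by (auto simp: nth_append)
      ultimately have "z < length Q0" using V Q by auto
      then show ?thesis
        using Q(3)[unfolded umbrella_def, rule_format, of x y z] xyz Q(1) True
        by (simp add: nth_append)
    next
      case False
      let ?k = "length Q0"
      have "prec nb b (Q1 ! (x - ?k)) (Q1 ! (y - ?k))" "prec nb b (Q1 ! (y - ?k)) (Q1 ! (z - ?k))"
        using Q(1,5) xyz False by (auto simp: sorted_wrt_iff_nth_less)
      then have "prec nb b (Q ! x) (Q ! y)" "prec nb b (Q ! y) (Q ! z)"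
        using Q(1) xyz False by (auto simp: nth_append)
      moreover have "Q ! x \<noteq> Q ! y" "Q ! y \<noteq> Q ! z"
        using V(2) xyz by (auto simp: nth_eq_iff_index_eq)
      moreover have "Q ! x \<in> V" "Q ! y \<in> V" "Q ! z \<in> V" using V xyz by auto
      ultimately show ?thesis using B.prec_umbrella xyz by blast
    qed
  qed
qed

lemma order_inv_step:
  assumes "search_step nb src x y" "search_inv src x" "order_inv x"
    "\<And>s. s \<in> set src \<Longrightarrow> s \<in> V \<and> extreme nb a s"
  shows "order_inv y"
  using assms
proof (induction rule: search_step.induct)
  case (append h Q w i f S)
  obtain Q0 Q1 r b where Q: "Q = Q0 @ Q1" "closed_under nb (set Q0)" "umbrella nb Q0"
    "length Q0 \<le> h" "b \<in> {a, \<lambda>u. - a u}" "sorted_wrt (prec nb b) Q1" "set Q1 \<subseteq> reach nb r"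
    "\<forall>x\<in>set Q1. \<forall>w\<in>reach nb r - set Q. prec nb b x w" "Q1 \<noteq> [] \<longrightarrow> r \<in> V"
    using append(5) unfolding order_inv_def prod.case by blast
  interpret B: unit_interval V nb b l using unit_interval_signed[OF Q(5)] .
  have V: "set Q \<subseteq> V" "distinct Q" and pr: "\<forall>x<h. nb (Q ! x) \<subseteq> set Q"
    using append unfolding search_inv_def by auto
  let ?p = "Q ! h"
  have p: "?p = Q1 ! (h - length Q0)" "?p \<in> set Q1" "?p \<in> V" using append(1) Q V
    by (auto simp: nth_append)
  have wr: "w \<in> reach nb r" using p Q append(2) reach_step by (metis DiffD1 subsetD)
  have rV: "r \<in> V" using Q(9) p(2) by auto
  have key: "prec nb b w v" if v: "v \<in> reach nb r - set (Q @ [w])" for v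
  proof -
    have "v \<in> V"
      using reach_subset_closed[of nb V r] v rV nb_subset by (auto simp: closed_under_def)
    show ?thesis
    proof (cases "v \<in> nb ?p")
      case True
      show ?thesis
      proof (rule B.prec_sibling[of ?p])
        \<comment> \<open>A visited neighbor \<open>z\<close> of the unvisited \<open>v\<close> is
          not exhausted, so its position is at least \<open>h\<close> and sortedness applies. For an
          unvisited \<open>z\<close> the invariant compares \<open>z\<close> with the current
          entry.\<close>
        fix z assume z: "z \<in> cnbhd nb v"
        show "prec nb b ?p z"
        proof (cases "z \<in> set Q")
          case zQ: True
          then obtain y where y: "y < length Q" "z = Q ! y" by (metis in_set_conv_nth)
          have "v \<in> nb z" using z v zQ nb_sym[OF \<open>v \<in> V\<close>] by (auto simp: cnbhd_def)
          moreover have "v \<notin> set Q" using v by simp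
          ultimately have "h \<le> y" using pr y(2) by (metis not_le subsetD)
          then show ?thesis
            using B.prec_refl Q(6) y p(1) Q(1,4)
            by (cases "h = y") (auto simp: sorted_wrt_iff_nth_less nth_append)
        next
          case False
          then have "z \<in> reach nb r" using z v reach_step by (auto simp: cnbhd_def)
          then show ?thesis using False Q(8) p by auto
        qed
      qed (use p append True v in auto)
    next
      case False
      moreover have "prec nb b ?p v" using v Q(8) p by auto
      moreover have "v \<noteq> ?p" using v append(1) by auto
      ultimately show ?thesis
        using B.prec_non_neighbour[of ?p w v] p append(2) \<open>v \<in> V\<close> by (auto simp: cnbhd_def)
    qed
  qed
  have "sorted_wrt (prec nb b) (Q1 @ [w])"
    using Q wr append(2) by (auto simp: sorted_wrt_append)
  then show ?case unfolding order_inv_def prod.case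
    by - (rule exI[of _ Q0], rule exI[of _ "Q1 @ [w]"], rule exI[of _ r], rule exI[of _ b],
      use Q(2,3,4,5,7,8) rV wr key in \<open>simp add: Q(1)\<close>)
next
  case (advance h Q i f S)
  from advance(4) show ?case unfolding order_inv_def prod.case
  proof (elim exE conjE, goal_cases)
    case (1 Q0 Q1 r b)
    then show ?case
      by - (rule exI[of _ Q0], rule exI[of _ Q1], rule exI[of _ r], rule exI[of _ b], simp)
  qed
next
  case (skip h Q i f S)
  then show ?case by (simp add: order_inv_def)
next
  case (start h Q i f S)
  \<comment> \<open>The old queue becomes \<open>Q0\<close>. Extremality of the new start supplies
    the direction \<open>b\<close> and compares the start with its whole component.\<close>
  have "extreme nb a (src ! i)" "src ! i \<in> V" using start by auto
  moreover from this obtain b where "b \<in> {a, \<lambda>u. - a u}" "\<forall>w\<in>reach nb (src ! i). prec nb b (src ! i) w"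
    by (auto simp: extreme_def)
  moreover have "umbrella nb Q" by (rule order_inv_umbrella[OF start(5,4)])
  moreover have "closed_under nb (set Q)" by (rule search_inv_closed[OF start(4,1)])
  ultimately show ?case unfolding order_inv_def prod.case
    by - (rule exI[of _ Q], rule exI[of _ "[src ! i]"], rule exI[of _ "src ! i"], rule exI[of _ b],
      use start(1) in auto)
qed

section \<open>Outcome of the two passes\<close>

lemma search_inv_run:
  assumes "(search_step nb src)\<^sup>*\<^sup>* (0, [], 0, False, []) x" "set src \<subseteq> V"
  shows "search_inv src x"
  using assms by induction (simp add: search_inv_def, blast intro: search_inv_step)

lemma search_starts:
  assumes "(search_step nb src)\<^sup>*\<^sup>* (0, [], 0, False, []) (length src, Q, length Q, f, S)"
    and src: "set src = V"
  shows "set S \<subseteq> V" "\<forall>s\<in>set S. extreme nb a s" "\<forall>w\<in>V. \<exists>s\<in>set S. w \<in> reach nb s"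
proof -
  have "start_inv x"
    if "(search_step nb src)\<^sup>*\<^sup>* (0, [], 0, False, []) x" for x
    using that
  proof induction
    case base
    show ?case by (simp add: start_inv_def closed_under_def)
  next
    case (step y z)
    then show ?case using start_inv_step search_inv_run src by blast
  qed
  then have st: "start_inv (length src, Q, length Q, f, S)" using assms by blast
  have si: "search_inv src (length src, Q, length Q, f, S)" using search_inv_run assms by blast
  then have "set Q = V" using src by (auto simp: search_inv_def)
  with start_inv_complete[OF st si refl]
  show "set S \<subseteq> V" "\<forall>s\<in>set S. extreme nb a s" "\<forall>w\<in>V. \<exists>s\<in>set S. w \<in> reach nb s"
    by auto
qed

lemma search_order:
  assumes run: "(search_step nb src)\<^sup>*\<^sup>* (0, [], 0, False, []) (length src, Q, length Q, f, S)"
    and src: "set src \<subseteq> V" "\<forall>s\<in>set src. extreme nb a s"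
      "\<forall>w\<in>V. \<exists>s\<in>set src. w \<in> reach nb s"
  shows "distinct Q" "set Q = V" "umbrella nb Q"
proof -
  have "order_inv x"
    if "(search_step nb src)\<^sup>*\<^sup>* (0, [], 0, False, []) x" for x
    using that
  proof induction
    case base
    show ?case
      by (simp add: order_inv_def closed_under_def umbrella_def) blast
  next
    case (step y z)
    then show ?case using order_inv_step[OF step(2)] search_inv_run src by blast
  qed
  then have oi: "order_inv (length src, Q, length Q, f, S)" using run by blast
  have si: "search_inv src (length src, Q, length Q, f, S)" using search_inv_run run src by blast
  show "umbrella nb Q" by (rule order_inv_umbrella[OF oi si])
  show "distinct Q" using si by (simp add: search_inv_def)
  have "closed_under nb (set Q)" by (rule search_inv_closed[OF si refl])
  moreover have "set src \<subseteq> set Q" "set Q \<subseteq> V" using si by (auto simp: search_inv_def)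
  ultimately show "set Q = V" using src(3) reach_subset_closed by (metis subset_antisym subsetD subsetI)
qed

end

section \<open>Windows and greedy hitting sets\<close>

text \<open>Used for the right neighbors of a position: the umbrella property leaves no gaps among
  them, so their number determines them.\<close>

lemma initial_segment_eq:
  assumes "finite A" "A \<subseteq> {x<..}" "\<And>y z. x < y \<Longrightarrow> y < z \<Longrightarrow> z \<in> A \<Longrightarrow> y \<in> A"
  shows "A = {x<..x + card A}"
proof (cases "A = {}")
  case False
  define m where "m = Max A"
  have "A = {x<..m}"
  proof
    show "A \<subseteq> {x<..m}" using assms(1,2) False by (auto simp: m_def)
    have "m \<in> A" using assms(1) False by (simp add: m_def)
    then show "{x<..m} \<subseteq> A" using assms(3) by (metis greaterThanAtMost_iff le_neq_implies_less subsetI)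
  qed
  moreover from this False have "x < m" by auto
  ultimately show ?thesis by simp
qed simp

locale umbrella_order =
  fixes nb :: "'v \<Rightarrow> 'v set" and Q :: "'v list" and c :: nat
  assumes distinct_Q: "distinct Q"
    and umbrella_Q: "umbrella nb Q"
    and nb_Q: "\<And>u v. u \<in> set Q \<Longrightarrow> v \<in> nb u \<Longrightarrow> v \<in> set Q \<and> u \<in> nb v \<and> u \<noteq> v"
    and c_pos: "1 \<le> c"
    and right_nbs: "\<And>x. x < length Q \<Longrightarrow> card {y. x < y \<and> y < length Q \<and> Q ! y \<in> nb (Q ! x)} \<le> c"
begin

definition rdeg :: "nat \<Rightarrow> nat" where
  "rdeg x = card {y. x < y \<and> y < length Q \<and> Q ! y \<in> nb (Q ! x)}"

text \<open>As right degrees are at most \<open>c\<close>, full right degree at \<open>x\<close> and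
  \<open>Suc x\<close> says that among the positions from \<open>x\<close> to
  \<open>x + c + 1\<close> the first \<open>c + 1\<close> and the last \<open>c + 1\<close> form
  cliques and that the two ends are not adjacent.\<close>

definition bad :: "nat \<Rightarrow> bool" where
  "bad x \<longleftrightarrow> Suc x < length Q \<and> rdeg x = c \<and> rdeg (Suc x) = c"

definition closed_without :: "'v set \<Rightarrow> bool" where
  "closed_without S \<longleftrightarrow> (\<forall>u\<in>set Q - S. \<forall>v\<in>set Q - S. u \<noteq> v \<and> v \<notin> nb u \<longrightarrow>
     card {w\<in>set Q - S. w \<in> nb u \<and> w \<in> nb v} \<le> c - 1)"

lemma right_nbs_eq:
  "{y. x < y \<and> y < length Q \<and> Q ! y \<in> nb (Q ! x)} = {x<..x + rdeg x}"
  unfolding rdeg_def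
proof (rule initial_segment_eq)
  fix y z
  assume "x < y" "y < z" "z \<in> {y. x < y \<and> y < length Q \<and> Q ! y \<in> nb (Q ! x)}"
  then show "y \<in> {y. x < y \<and> y < length Q \<and> Q ! y \<in> nb (Q ! x)}"
    using umbrella_Q[unfolded umbrella_def, rule_format, of x y z] by simp
qed auto

lemma right_nb_iff: "x < y \<Longrightarrow> y < length Q \<Longrightarrow> Q ! y \<in> nb (Q ! x) \<longleftrightarrow> y \<le> x + rdeg x"
  using right_nbs_eq[of x] by (auto simp only: set_eq_iff mem_Collect_eq greaterThanAtMost_iff)

lemma rdeg_bound:
  assumes "x < length Q" shows "x + rdeg x < length Q"
proof (cases "rdeg x = 0")
  case False
  then have "x + rdeg x \<in> {x<..x + rdeg x}" by simp
  then show ?thesis unfolding right_nbs_eq[symmetric] by simp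
qed (use assms in simp)

lemma rdeg_le: "x < length Q \<Longrightarrow> rdeg x \<le> c"
  using right_nbs by (simp add: rdeg_def)

lemma nb_nth_sym: "x < length Q \<Longrightarrow> y < length Q \<Longrightarrow> Q ! y \<in> nb (Q ! x) \<longleftrightarrow> Q ! x \<in> nb (Q ! y)"
  using nb_Q nth_mem by blast

lemma nth_notin_nb: "x < length Q \<Longrightarrow> Q ! x \<notin> nb (Q ! x)"
  using nb_Q nth_mem by blast

text \<open>A common neighbor before \<open>x\<close> or after \<open>y\<close> would have an edge
  spanning both, and the umbrella property would make \<open>x\<close> and \<open>y\<close>
  adjacent. Only positions in between remain.\<close>

lemma common_nbs:
  assumes "x < y" "y < length Q" "x + rdeg x < y" "z < length Q"
  shows "Q ! z \<in> nb (Q ! x) \<and> Q ! z \<in> nb (Q ! y) \<longleftrightarrow> x < z \<and> z \<le> x + rdeg x \<and> y \<le> z + rdeg z"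
proof -
  have na: "Q ! y \<notin> nb (Q ! x)" using assms right_nb_iff by auto
  have um: "Q ! v \<in> nb (Q ! u) \<and> Q ! w \<in> nb (Q ! v)"
    if "u < v" "v < w" "w < length Q" "Q ! w \<in> nb (Q ! u)" for u v w
    using umbrella_Q that unfolding umbrella_def by blast
  consider "z < x" | "z = x" | "x < z" "z < y" | "z = y" | "y < z" by linarith
  then show ?thesis
  proof cases
    case 1
    then show ?thesis using um[of z x y] assms na nb_nth_sym[of z y] by auto
  next
    case 2
    then show ?thesis using nth_notin_nb assms by auto
  next
    case 3
    then show ?thesis using assms right_nb_iff[of x z] right_nb_iff[of z y] nb_nth_sym[of z y] by auto
  next
    case 4
    then show ?thesis using nth_notin_nb assms by auto
  next
    case 5
    then show ?thesis using um[of x y z] assms na by auto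
  qed
qed

section \<open>Bad windows as the only obstructions\<close>

lemma card_vertices:
  "card {w\<in>set Q - S. P w} = card {z. z < length Q \<and> Q ! z \<notin> S \<and> P (Q ! z)}"
proof -
  have "{w\<in>set Q - S. P w} = (!) Q ` {z. z < length Q \<and> Q ! z \<notin> S \<and> P (Q ! z)}"
    by (auto simp: in_set_conv_nth)
  moreover have "inj_on ((!) Q) {z. z < length Q \<and> Q ! z \<notin> S \<and> P (Q ! z)}"
    using distinct_Q by (auto simp: inj_on_def nth_eq_iff_index_eq)
  ultimately show ?thesis by (simp add: card_image)
qed

text \<open>The ends of an untouched bad window survive, are not adjacent, and share all
  \<open>c\<close> inner vertices.\<close>

lemma hit_if_closed:
  assumes "closed_without S" "bad x"
  shows "\<exists>y. x \<le> y \<and> y \<le> x + c + 1 \<and> Q ! y \<in> S"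
proof (rule ccontr)
  assume "\<not> ?thesis"
  then have S: "Q ! y \<notin> S" if "x \<le> y" "y \<le> x + c + 1" for y using that by auto
  have b: "Suc x < length Q" "rdeg x = c" "rdeg (Suc x) = c" using assms(2) by (auto simp: bad_def)
  have l: "x + c + 1 < length Q" using rdeg_bound[OF b(1)] b by simp
  let ?y = "x + c + 1"
  have "Q ! ?y \<notin> nb (Q ! x)" using right_nb_iff[of x ?y] l b by simp
  moreover have "Q ! x \<noteq> Q ! ?y" using distinct_Q l by (simp add: nth_eq_iff_index_eq)
  moreover have "Q ! x \<in> set Q - S" "Q ! ?y \<in> set Q - S" using S l by auto
  ultimately have "card {w\<in>set Q - S. w \<in> nb (Q ! x) \<and> w \<in> nb (Q ! ?y)} \<le> c - 1"
    using assms(1) unfolding closed_without_def by blast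
  moreover have "{z. z < length Q \<and> Q ! z \<notin> S \<and> Q ! z \<in> nb (Q ! x) \<and> Q ! z \<in> nb (Q ! ?y)} = {x<..x + c}"
  proof (rule set_eqI)
    fix z
    \<comment> \<open>\<open>Suc x\<close> reaches the right end by its full right degree, and the
      umbrella property passes this on to the other inner vertices.\<close>
    have "?y \<le> z + rdeg z" if "x < z" "z \<le> x + c"
    proof (cases "z = Suc x")
      case False
      have "Q ! ?y \<in> nb (Q ! Suc x)" using right_nb_iff[of "Suc x" ?y] l b c_pos by simp
      then have "Q ! ?y \<in> nb (Q ! z)"
        using umbrella_Q[unfolded umbrella_def, rule_format, of "Suc x" z ?y] that False l by auto
      then show ?thesis using right_nb_iff[of z ?y] that l by simp
    qed (use b in simp)
    then show "z \<in> {z. z < length Q \<and> Q ! z \<notin> S \<and> Q ! z \<in> nb (Q ! x) \<and> Q ! z \<in> nb (Q ! ?y)}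
        \<longleftrightarrow> z \<in> {x<..x + c}"
      using common_nbs[of x ?y z] S[of z] l b by auto
  qed
  ultimately show False using c_pos unfolding card_vertices by simp
qed

text \<open>A surviving nonadjacent pair with \<open>c\<close> common neighbors finds them among the
  at most \<open>c\<close> right neighbors of its left member, so it shares all of these and none is
  deleted. The first of them has to reach the right member, which forces the distance
  \<open>c + 1\<close>. The pair thus spans a bad window that \<open>S\<close> does not
  meet.\<close>

lemma closed_if_hit:
  assumes hit: "\<And>x. bad x \<Longrightarrow> \<exists>y. x \<le> y \<and> y \<le> x + c + 1 \<and> Q ! y \<in> S"
  shows "closed_without S"
proof -
  have main: "card {w\<in>set Q - S. w \<in> nb (Q ! x) \<and> w \<in> nb (Q ! y)} \<le> c - 1"
    if xy: "x < y" "y < length Q" "Q ! y \<notin> nb (Q ! x)" "Q ! x \<notin> S" "Q ! y \<notin> S" for x y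
  proof (rule ccontr)
    let ?Z = "{z. z < length Q \<and> Q ! z \<notin> S \<and> Q ! z \<in> nb (Q ! x) \<and> Q ! z \<in> nb (Q ! y)}"
    assume "\<not> ?thesis"
    then have Z: "c \<le> card ?Z" unfolding card_vertices by simp
    have far: "x + rdeg x < y" using xy right_nb_iff by auto
    have rx: "rdeg x \<le> c" using rdeg_le xy by simp
    have sub: "?Z \<subseteq> {x<..x + rdeg x}"
    proof
      fix z assume "z \<in> ?Z"
      then show "z \<in> {x<..x + rdeg x}" using common_nbs[OF xy(1,2) far, of z] by simp
    qed
    then have "card ?Z \<le> rdeg x" using card_mono[OF _ sub] by simp
    then have rc: "rdeg x = c" using Z rx by simp
    have Zeq: "?Z = {x<..x + c}"
      using card_subset_eq[OF _ sub] Z rc \<open>card ?Z \<le> rdeg x\<close> by simp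
    have "Suc x \<in> ?Z" using Zeq c_pos by auto
    then have "y \<le> Suc x + rdeg (Suc x)" using common_nbs[OF xy(1,2) far, of "Suc x"] by simp
    moreover have "rdeg (Suc x) \<le> c" using rdeg_le xy by simp
    ultimately have y: "y = x + c + 1" "rdeg (Suc x) = c" using far rc by auto
    then have "bad x" using xy rc by (simp add: bad_def)
    then obtain z where z: "x \<le> z" "z \<le> y" "Q ! z \<in> S" using hit y by auto
    then have "x < z" "z < y" using xy by (metis le_neq_implies_less)+
    then have "z \<in> ?Z" unfolding Zeq using y by simp
    then show False using z by simp
  qed
  show ?thesis unfolding closed_without_def
  proof (intro ballI impI)
    fix u v assume u: "u \<in> set Q - S" and v: "v \<in> set Q - S" and uv: "u \<noteq> v \<and> v \<notin> nb u"
    obtain x y where x: "x < length Q" "u = Q ! x" and y: "y < length Q" "v = Q ! y"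
      using u v by (metis DiffD1 in_set_conv_nth)
    consider "x < y" | "y < x" using uv x y by (metis linorder_neqE_nat)
    then show "card {w \<in> set Q - S. w \<in> nb u \<and> w \<in> nb v} \<le> c - 1"
    proof cases
      case 1
      then show ?thesis using main[of x y] u v uv x y by simp
    next
      case 2
      then show ?thesis using main[of y x] u v uv x y nb_nth_sym[of x y]
        by (simp add: conj_commute)
    qed
  qed
qed

section \<open>Greedy selection of windows\<close>

definition greedy :: "nat set \<Rightarrow> bool" where
  "greedy P \<longleftrightarrow> finite P \<and> (\<forall>p\<in>P. bad p) \<and> (\<forall>p\<in>P. \<forall>q\<in>P. p < q \<longrightarrow> p + c + 1 < q) \<and>
     (\<forall>x. bad x \<longrightarrow> (\<exists>p\<in>P. p \<le> x \<and> x \<le> p + c + 1))"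

text \<open>Packing against covering: the selected windows are pairwise disjoint, so every solution
  spends a vertex on each of them, while their last vertices already meet all bad windows.\<close>

lemma greedy_optimal:
  assumes "greedy P"
  shows "(\<exists>S\<subseteq>set Q. card S \<le> k \<and> closed_without S) \<longleftrightarrow> card P \<le> k"
proof
  assume "\<exists>S\<subseteq>set Q. card S \<le> k \<and> closed_without S"
  then obtain S where S: "S \<subseteq> set Q" "card S \<le> k" "closed_without S" by blast
  then have "\<forall>p\<in>P. \<exists>y. p \<le> y \<and> y \<le> p + c + 1 \<and> Q ! y \<in> S"
    using hit_if_closed assms unfolding greedy_def by blast
  then obtain h where h: "\<And>p. p \<in> P \<Longrightarrow> p \<le> h p \<and> h p \<le> p + c + 1 \<and> Q ! h p \<in> S" by metis
  \<comment> \<open>Indexing past the end of \<open>Q\<close> is unspecified, so distinctness can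
    identify positions only after this bound.\<close>
  have bnd: "h p < length Q" if "p \<in> P" for p
  proof -
    have "bad p" using that assms unfolding greedy_def by blast
    then have "Suc p + rdeg (Suc p) < length Q" "rdeg (Suc p) = c"
      using rdeg_bound[of "Suc p"] by (auto simp: bad_def)
    then show ?thesis using h[OF that] by simp
  qed
  have "inj_on (\<lambda>p. Q ! h p) P"
  proof (rule inj_onI)
    fix p q assume pq: "p \<in> P" "q \<in> P" "Q ! h p = Q ! h q"
    then have "h p = h q" using bnd distinct_Q by (simp add: nth_eq_iff_index_eq)
    moreover have sep: "\<And>p q. p \<in> P \<Longrightarrow> q \<in> P \<Longrightarrow> p < q \<Longrightarrow> p + c + 1 < q"
      using assms unfolding greedy_def by blast
    ultimately show "p = q"
      using h[OF pq(1)] h[OF pq(2)] sep[OF pq(1,2)] sep[OF pq(2,1)]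
      by (metis le_trans linorder_neqE_nat not_less)
  qed
  moreover have "(\<lambda>p. Q ! h p) ` P \<subseteq> S" using h by blast
  moreover have "finite S" using S(1) finite_subset by blast
  ultimately show "card P \<le> k" using S(2) card_inj_on_le[of "\<lambda>p. Q ! h p" P S] by simp
next
  assume k: "card P \<le> k"
  let ?S = "(\<lambda>p. Q ! (p + c + 1)) ` P"
  have "?S \<subseteq> set Q"
  proof
    fix v assume "v \<in> ?S"
    then obtain p where p: "p \<in> P" "v = Q ! (p + c + 1)" by blast
    then have "bad p" using assms unfolding greedy_def by blast
    then have "Suc p + rdeg (Suc p) < length Q" "rdeg (Suc p) = c"
      using rdeg_bound[of "Suc p"] by (auto simp: bad_def)
    then show "v \<in> set Q" using p by auto
  qed
  moreover have "card ?S \<le> k"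
    using k card_image_le[of P "\<lambda>p. Q ! (p + c + 1)"] assms unfolding greedy_def by simp
  moreover have "closed_without ?S"
  proof (rule closed_if_hit)
    fix x assume "bad x"
    then obtain p where "p \<in> P" "p \<le> x \<and> x \<le> p + c + 1"
      using assms unfolding greedy_def by blast
    then show "\<exists>y. x \<le> y \<and> y \<le> x + c + 1 \<and> Q ! y \<in> ?S"
      by (intro exI[of _ "p + c + 1"]) auto
  qed
  ultimately show "\<exists>S\<subseteq>set Q. card S \<le> k \<and> closed_without S" by blast
qed

text \<open>Of the bad windows starting before \<open>i - 1\<close>, the set \<open>P\<close> has been selected; the next \<open>w\<close>
  windows are met by the last selected one.\<close>

definition greedy_inv :: "nat \<Rightarrow> nat \<Rightarrow> nat set \<Rightarrow> bool" where
  "greedy_inv i w P \<longleftrightarrow> finite P \<and> (\<forall>p\<in>P. bad p \<and> Suc p < i \<and> p + c + 3 \<le> i + w) \<and>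
     (\<forall>p\<in>P. \<forall>q\<in>P. p < q \<longrightarrow> p + c + 1 < q) \<and>
     (0 < w \<longrightarrow> (\<exists>p\<in>P. p + c + 3 = i + w)) \<and>
     (\<forall>x. bad x \<and> Suc x < i \<longrightarrow> (\<exists>p\<in>P. p \<le> x \<and> x \<le> p + c + 1))"

lemma greedy_inv_empty: "greedy_inv 0 0 {}"
  by (simp add: greedy_inv_def)

text \<open>The last vertex of the window at \<open>x\<close> has position \<open>x + c + 1\<close>
  and also meets the \<open>c + 1\<close> windows that start after \<open>x\<close> and not after
  it; hence the new count \<open>Suc c\<close>. The old count \<open>0\<close> means that all
  earlier selected windows end before \<open>x\<close>.\<close>

lemma greedy_inv_select:
  assumes "greedy_inv (Suc x) 0 P" "bad x"
  shows "greedy_inv (Suc (Suc x)) (Suc c) (insert x P)" "x \<notin> P"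
proof -
  have P: "bad p" "p + c + 2 \<le> x" if "p \<in> P" for p
    using assms(1) that unfolding greedy_inv_def by auto
  then show "x \<notin> P" by force
  have "\<exists>p\<in>insert x P. p \<le> y \<and> y \<le> p + c + 1" if "bad y" "Suc y < Suc (Suc x)" for y
    using assms(1) that unfolding greedy_inv_def by (cases "y = x") auto
  moreover have "bad p \<and> Suc p < Suc (Suc x) \<and> p + c + 3 \<le> Suc (Suc x) + Suc c"
    if "p \<in> insert x P" for p
    using that assms(2) P[of p] by auto
  moreover have "p + c + 1 < q" if "p \<in> insert x P" "q \<in> insert x P" "p < q" for p q
    using assms(1) that P[of p] P[of q] unfolding greedy_inv_def by auto
  moreover have "finite (insert x P)" using assms(1) by (simp add: greedy_inv_def)
  moreover have "\<exists>p\<in>insert x P. p + c + 3 = Suc (Suc x) + Suc c" by simp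
  ultimately show "greedy_inv (Suc (Suc x)) (Suc c) (insert x P)"
    unfolding greedy_inv_def by blast
qed

lemma greedy_inv_ignore:
  assumes "greedy_inv i 0 P" "0 < i \<Longrightarrow> \<not> bad (i - 1)"
  shows "greedy_inv (Suc i) 0 P"
proof -
  have "Suc y < i" if "bad y" "Suc y < Suc i" for y
    using that assms(2) by (cases "Suc y = i") auto
  then have "\<exists>p\<in>P. p \<le> y \<and> y \<le> p + c + 1" if "bad y" "Suc y < Suc i" for y
    using assms(1) that unfolding greedy_inv_def by blast
  moreover have "bad p \<and> Suc p < Suc i \<and> p + c + 3 \<le> Suc i + 0" if "p \<in> P" for p
    using assms(1) that unfolding greedy_inv_def by auto
  ultimately show ?thesis using assms(1) unfolding greedy_inv_def by blast
qed

lemma greedy_inv_wait: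
  assumes "greedy_inv i (Suc w) P"
  shows "greedy_inv (Suc i) w P"
proof -
  obtain p where p: "p \<in> P" "p + c + 3 = i + Suc w" "Suc p < i"
    using assms unfolding greedy_inv_def by blast
  have "\<exists>p\<in>P. p \<le> y \<and> y \<le> p + c + 1" if "bad y" "Suc y < Suc i" for y
  proof (cases "Suc y = i")
    case True
    then show ?thesis using p by (intro bexI[of _ p]) auto
  next
    case False
    then show ?thesis using assms that unfolding greedy_inv_def by auto
  qed
  moreover have "\<exists>p\<in>P. p + c + 3 = Suc i + w" using p by auto
  moreover have "bad p \<and> Suc p < Suc i \<and> p + c + 3 \<le> Suc i + w" if "p \<in> P" for p
    using assms that unfolding greedy_inv_def by auto
  ultimately show ?thesis using assms unfolding greedy_inv_def by blast
qed

lemma greedy_inv_greedy: "greedy_inv (length Q) w P \<Longrightarrow> greedy P"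
  unfolding greedy_inv_def greedy_def by (auto simp: bad_def)

end

section \<open>Time credits\<close>

text \<open>Total correctness with time credits: \<open>f\<close> bounds the running time, and the
  postcondition receives the unspent rest, so that a loop invariant can relate credit to progress.
  The rules for loop-free constructs are equivalences, which lets simplification execute
  them.\<close>

definition wp :: "prog \<Rightarrow> (state \<Rightarrow> nat \<Rightarrow> bool) \<Rightarrow> state \<Rightarrow> nat \<Rightarrow> bool" where
  "wp p Q s f \<longleftrightarrow> (\<exists>t s'. exec p s t s' \<and> t \<le> f \<and> Q s' (f - t))"

lemma wp_Skip [simp]: "wp Skip Q s f \<longleftrightarrow> 1 \<le> f \<and> Q s (f - 1)"
  unfolding wp_def by (metis exec_Skip exec_SkipE)

lemma wp_Assign [simp]:
  "wp (Assign x e) Q s f \<longleftrightarrow> 1 + exp_cost e \<le> f \<and>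
     Q (s\<lparr>reg := (reg s)(x := eval_exp e s)\<rparr>) (f - (1 + exp_cost e))"
  unfolding wp_def by (metis exec_Assign exec_AssignE)

lemma wp_Write [simp]:
  "wp (Write a e e') Q s f \<longleftrightarrow> 1 + exp_cost e + exp_cost e' \<le> f \<and>
     Q (s\<lparr>arr := (arr s)(a := (arr s a)(eval_exp e s := eval_exp e' s))\<rparr>)
       (f - (1 + exp_cost e + exp_cost e'))"
  unfolding wp_def by (metis exec_Write exec_WriteE)

lemma wp_Seq [simp]: "wp (Seq p q) Q s f \<longleftrightarrow> wp p (wp q Q) s f"
proof
  assume "wp (Seq p q) Q s f"
  then obtain t s' where 1: "exec (Seq p q) s t s'" "t \<le> f" "Q s' (f - t)"
    unfolding wp_def by blast
  from 1(1) obtain t1 t2 s1 where "exec p s t1 s1" "exec q s1 t2 s'" "t = t1 + t2"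
    by (rule exec_SeqE) metis
  with 1 show "wp p (wp q Q) s f" unfolding wp_def
    by - (rule exI[of _ t1], rule exI[of _ s1], simp, rule exI[of _ t2], rule exI[of _ s'], simp)
next
  assume "wp p (wp q Q) s f"
  then obtain t1 t2 s1 s2 where
    "exec p s t1 s1" "t1 \<le> f" "exec q s1 t2 s2" "t2 \<le> f - t1" "Q s2 (f - t1 - t2)"
    unfolding wp_def by blast
  then show "wp (Seq p q) Q s f" unfolding wp_def
    by - (rule exI[of _ "t1 + t2"], rule exI[of _ s2], auto intro: exec_Seq)
qed

lemma wp_IfElse [simp]:
  "wp (IfElse b p q) Q s f \<longleftrightarrow> 1 + test_cost b \<le> f \<and>
     (if eval_test b s then wp p Q s (f - (1 + test_cost b)) else wp q Q s (f - (1 + test_cost b)))"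
proof
  assume "wp (IfElse b p q) Q s f"
  then obtain t s' where 1: "exec (IfElse b p q) s t s'" "t \<le> f" "Q s' (f - t)"
    unfolding wp_def by blast
  have "\<exists>u. t = 1 + test_cost b + u \<and> exec (if eval_test b s then p else q) s u s'"
    using 1(1) by cases auto
  then obtain u where u: "t = 1 + test_cost b + u"
    "exec (if eval_test b s then p else q) s u s'" by blast
  have "wp (if eval_test b s then p else q) Q s (f - (1 + test_cost b))" unfolding wp_def
    by (rule exI[of _ u], rule exI[of _ s']) (use 1 u in simp)
  with 1 u show "1 + test_cost b \<le> f \<and>
     (if eval_test b s then wp p Q s (f - (1 + test_cost b)) else wp q Q s (f - (1 + test_cost b)))"
    by (simp split: if_splits)
next
  assume "1 + test_cost b \<le> f \<and>
     (if eval_test b s then wp p Q s (f - (1 + test_cost b)) else wp q Q s (f - (1 + test_cost b)))"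
  then obtain t s' where "exec (if eval_test b s then p else q) s t s'"
    "t \<le> f - (1 + test_cost b)" "1 + test_cost b \<le> f" "Q s' (f - (1 + test_cost b) - t)"
    unfolding wp_def by (auto split: if_splits)
  then show "wp (IfElse b p q) Q s f" unfolding wp_def
    by - (rule exI[of _ "1 + test_cost b + t"], rule exI[of _ s'],
      use exec_If_True[of b s p t s' q] exec_If_False[of b s q t s' p] in \<open>auto split: if_splits\<close>)
qed

text \<open>Every iteration consumes credit, so the credit bound already forces termination.\<close>

lemma wp_While:
  assumes "I s f"
    and body: "\<And>s f. I s f \<Longrightarrow> eval_test b s \<Longrightarrow>
      1 + test_cost b \<le> f \<and> wp p I s (f - (1 + test_cost b))"
    and exit: "\<And>s f. I s f \<Longrightarrow> \<not> eval_test b s \<Longrightarrow>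
      1 + test_cost b \<le> f \<and> Q s (f - (1 + test_cost b))"
  shows "wp (While b p) Q s f"
  using assms(1)
proof (induction f arbitrary: s rule: less_induct)
  case (less f)
  show ?case
  proof (cases "eval_test b s")
    case True
    let ?f = "f - (1 + test_cost b)"
    from body[OF less.prems True] obtain t s' where
      1: "1 + test_cost b \<le> f" "exec p s t s'" "t \<le> ?f" "I s' (?f - t)"
      unfolding wp_def by blast
    with less.IH[of "?f - t" s'] obtain u s'' where
      "exec (While b p) s' u s''" "u \<le> ?f - t" "Q s'' (?f - t - u)"
      unfolding wp_def by auto
    with 1 True show ?thesis unfolding wp_def
      by - (rule exI[of _ "1 + test_cost b + t + u"], rule exI[of _ s''],
        use exec_While_True[of b s p t s' u s''] in simp)
  next
    case False
    with exit[OF less.prems False] show ?thesis unfolding wp_def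
      by - (rule exI[of _ "1 + test_cost b"], rule exI[of _ s],
        use exec_While_False[of b s p] in simp)
  qed
qed

section \<open>The program\<close>

text \<open>Array \<open>e\<close> holds the degrees, with the sentinel \<open>n\<close> at index \<open>n\<close>, which no degree reaches:
  \<open>b = n\<close> stands for an entry without unvisited neighbors.  The queue \<open>q\<close> has \<open>m\<close> entries, of which
  the first \<open>h\<close> are exhausted; \<open>f\<close> records whether entry \<open>h\<close> has a child.  Step
  \<open>i\<close> of the greedy scan treats the window that starts at position \<open>i - 1\<close>; \<open>w\<close> is the number of
  further windows met by the last deleted vertex.\<close>

definition count_prog :: "exp \<Rightarrow> test \<Rightarrow> prog" where
  "count_prog u b =
    Seq (Assign ''x'' (Read ''off'' u))
    (Seq (Assign ''d'' (Const 0))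
    (While (Less (Reg ''x'') (Read ''off'' (Inc u)))
      (Seq (IfElse b (Assign ''d'' (Inc (Reg ''d''))) Skip)
        (Assign ''x'' (Inc (Reg ''x''))))))"

definition degree_prog :: prog where
  "degree_prog =
    Seq (Assign ''u'' (Const 0))
    (Seq (While (Less (Reg ''u'') (Reg ''n''))
      (Seq (count_prog (Reg ''u'') (Equal (Const 0) (Const 0)))
      (Seq (Write ''e'' (Reg ''u'') (Reg ''d''))
      (Seq (Write ''a'' (Reg ''u'') (Reg ''u''))
        (Assign ''u'' (Inc (Reg ''u'')))))))
    (Write ''e'' (Reg ''n'') (Reg ''n'')))"

definition scan_prog :: "string \<Rightarrow> prog" where
  "scan_prog z =
    Seq (Assign ''x'' (Read ''off'' (Read ''q'' (Reg ''h''))))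
    (Seq (Assign ''b'' (Reg ''n''))
    (While (Less (Reg ''x'') (Read ''off'' (Inc (Read ''q'' (Reg ''h'')))))
      (Seq (IfElse (Conj (Equal (Read z (Read ''tgt'' (Reg ''x''))) (Const 0))
              (Less (Read ''e'' (Read ''tgt'' (Reg ''x''))) (Read ''e'' (Reg ''b''))))
            (Assign ''b'' (Read ''tgt'' (Reg ''x''))) Skip)
        (Assign ''x'' (Inc (Reg ''x''))))))"

definition search_body :: "string \<Rightarrow> string \<Rightarrow> string \<Rightarrow> prog" where
  "search_body src dst z =
    IfElse (Less (Reg ''h'') (Reg ''m''))
      (Seq (scan_prog z)
        (IfElse (Less (Reg ''b'') (Reg ''n''))
          (Seq (Write ''q'' (Reg ''m'') (Reg ''b''))
          (Seq (Assign ''m'' (Inc (Reg ''m'')))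
          (Seq (Write z (Reg ''b'') (Reg ''m''))
          (IfElse (Equal (Reg ''f'') (Const 0))
            (Seq (Write dst (Dec (Reg ''j'')) (Reg ''b'')) (Assign ''f'' (Const 1)))
            Skip))))
          (Seq (Assign ''h'' (Inc (Reg ''h''))) (Assign ''f'' (Const 0)))))
      (Seq (Assign ''v'' (Read src (Reg ''i'')))
      (Seq (Assign ''i'' (Inc (Reg ''i'')))
      (IfElse (Equal (Read z (Reg ''v'')) (Const 0))
        (Seq (Write ''q'' (Reg ''m'') (Reg ''v''))
        (Seq (Assign ''m'' (Inc (Reg ''m'')))
        (Seq (Write z (Reg ''v'') (Reg ''m''))
        (Seq (Assign ''f'' (Const 0))
        (Seq (Write dst (Reg ''j'') (Reg ''v''))
          (Assign ''j'' (Inc (Reg ''j''))))))))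
        Skip)))"

definition search_prog :: "string \<Rightarrow> string \<Rightarrow> string \<Rightarrow> prog" where
  "search_prog src dst z =
    Seq (Assign ''i'' (Const 0))
    (Seq (Assign ''m'' (Const 0))
    (Seq (Assign ''h'' (Const 0))
    (Seq (Assign ''j'' (Const 0))
    (Seq (Assign ''f'' (Const 0))
    (While (Neg (Conj (Neg (Less (Reg ''h'') (Reg ''m''))) (Neg (Less (Reg ''i'') (Reg ''l'')))))
      (search_body src dst z))))))"

text \<open>Comparing stored positions counts only later neighbors, so \<open>d\<close> becomes the
  right degree at position \<open>i\<close>. Register \<open>g\<close> remembers whether the
  preceding position had right degree \<open>c\<close>; both conditions together say that the window
  at \<open>i - 1\<close> is bad.\<close>

definition greedy_body :: prog where
  "greedy_body =
    Seq (count_prog (Read ''q'' (Reg ''i''))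
        (Less (Read ''z'' (Read ''q'' (Reg ''i''))) (Read ''z'' (Read ''tgt'' (Reg ''x'')))))
    (Seq (IfElse (Equal (Reg ''w'') (Const 0))
        (IfElse (Conj (Equal (Reg ''g'') (Const 1)) (Equal (Reg ''d'') (Reg ''c'')))
          (Seq (Assign ''r'' (Inc (Reg ''r''))) (Assign ''w'' (Inc (Reg ''c''))))
          Skip)
        (Assign ''w'' (Dec (Reg ''w''))))
    (Seq (IfElse (Equal (Reg ''d'') (Reg ''c'')) (Assign ''g'' (Const 1)) (Assign ''g'' (Const 0)))
      (Assign ''i'' (Inc (Reg ''i'')))))"

definition greedy_prog :: prog where
  "greedy_prog =
    Seq (Assign ''i'' (Const 0))
    (Seq (Assign ''g'' (Const 0))
    (Seq (Assign ''w'' (Const 0))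
    (Seq (Assign ''r'' (Const 0))
    (Seq (While (Less (Reg ''i'') (Reg ''n'')) greedy_body)
      (IfElse (Less (Reg ''k'') (Reg ''r'')) (Assign ''out'' (Const 0)) (Assign ''out'' (Const 1)))))))"

text \<open>Each pass has its own position array, so no visited marks need clearing. The list
  \<open>s\<close> collected by the first pass supplies the start candidates of the second.\<close>

definition deletion_prog :: prog where
  "deletion_prog =
    Seq degree_prog
    (Seq (Assign ''l'' (Reg ''n''))
    (Seq (search_prog ''a'' ''s'' ''y'')
    (Seq (Assign ''l'' (Reg ''j''))
    (Seq (search_prog ''s'' ''t'' ''z'')
      greedy_prog))))"

section \<open>Adjacency lists in memory\<close>

locale adjacency_input =
  fixes L :: "nat list list" and D :: nat
  assumes L_less: "\<And>u w. u < length L \<Longrightarrow> w \<in> set (L ! u) \<Longrightarrow> w < length L"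
    and L_distinct: "\<And>u. u < length L \<Longrightarrow> distinct (L ! u)"
    and L_length: "\<And>u. u < length L \<Longrightarrow> length (L ! u) \<le> D"
    and L_length_less: "\<And>u. u < length L \<Longrightarrow> length (L ! u) < length L"
begin

definition offset :: "nat \<Rightarrow> nat" where
  "offset u = length (concat (take u L))"

definition nb :: "nat \<Rightarrow> nat set" where
  "nb u = set (L ! u)"

definition graph_stored :: "state \<Rightarrow> bool" where
  "graph_stored s \<longleftrightarrow> reg s ''n'' = length L \<and>
     (\<forall>u\<le>length L. arr s ''off'' u = offset u) \<and>
     (\<forall>u<length L. \<forall>j<length (L ! u). arr s ''tgt'' (offset u + j) = L ! u ! j)"

lemma offset_Suc: "u < length L \<Longrightarrow> offset (Suc u) = offset u + length (L ! u)"
  by (simp add: offset_def take_Suc_conv_app_nth)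

lemma concat_nth_offset:
  assumes "u < length L" "j < length (L ! u)"
  shows "offset u + j < length (concat L)" "concat L ! (offset u + j) = L ! u ! j"
proof -
  have "concat L = concat (take u L) @ L ! u @ concat (drop (Suc u) L)"
    by (metis append_Cons append_take_drop_id assms(1) concat.simps(2) concat_append Cons_nth_drop_Suc)
  then show "offset u + j < length (concat L)" "concat L ! (offset u + j) = L ! u ! j"
    using assms(2) by (auto simp: offset_def nth_append)
qed

lemma graph_stored_input: "graph_stored (input_state c k L)"
  using concat_nth_offset by (simp add: graph_stored_def input_state_def offset_def)

text \<open>Stated for an arbitrary vertex expression and test, since the same loop computes degrees
  and right degrees. Both must be insensitive to the counter \<open>d\<close>, and the vertex
  expression also to \<open>x\<close>. With the cost limits assumed, an iteration takes less than 50
  units.\<close>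

lemma wp_count_prog:
  assumes st: "graph_stored s" and u: "u < length L"
    and ue: "\<And>s'. arr s' = arr s \<Longrightarrow> (\<And>y. y \<noteq> ''x'' \<Longrightarrow> y \<noteq> ''d'' \<Longrightarrow> reg s' y = reg s y) \<Longrightarrow>
      eval_exp ue s' = u"
    and b: "\<And>s' j. arr s' = arr s \<Longrightarrow> (\<And>y. y \<noteq> ''x'' \<Longrightarrow> y \<noteq> ''d'' \<Longrightarrow> reg s' y = reg s y) \<Longrightarrow>
      reg s' ''x'' = offset u + j \<Longrightarrow> j < length (L ! u) \<Longrightarrow> eval_test b s' \<longleftrightarrow> P (L ! u ! j)"
    and cost: "exp_cost ue \<le> 5" "test_cost b \<le> 20"
    and f: "60 * (length (L ! u) + 1) \<le> f"
    and Q: "\<And>s' f'. arr s' = arr s \<Longrightarrow> (\<And>y. y \<noteq> ''x'' \<Longrightarrow> y \<noteq> ''d'' \<Longrightarrow> reg s' y = reg s y) \<Longrightarrow>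
      reg s' ''d'' = length (filter P (L ! u)) \<Longrightarrow> f \<le> f' + 60 * (length (L ! u) + 1) \<Longrightarrow> Q s' f'"
  shows "wp (count_prog ue b) Q s f"
proof -
  define I where "I = (\<lambda>(s' :: state) f'. \<exists>j\<le>length (L ! u). arr s' = arr s \<and>
    (\<forall>y. y \<noteq> ''x'' \<longrightarrow> y \<noteq> ''d'' \<longrightarrow> reg s' y = reg s y) \<and> reg s' ''x'' = offset u + j \<and>
    reg s' ''d'' = length (filter P (take j (L ! u))) \<and> f \<le> f' + 20 + 50 * j)"
  have off: "arr s ''off'' u = offset u" "arr s ''off'' (Suc u) = offset u + length (L ! u)"
    using st u offset_Suc[OF u] by (auto simp: graph_stored_def)
  have ev: "eval_exp ue s' = u"
    if "arr s' = arr s" "\<forall>y. y \<noteq> ''x'' \<longrightarrow> y \<noteq> ''d'' \<longrightarrow> reg s' y = reg s y" for s'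
    using ue that by blast
  have loop: "wp (While (Less (Reg ''x'') (Read ''off'' (Inc ue)))
      (Seq (IfElse b (Assign ''d'' (Inc (Reg ''d''))) Skip) (Assign ''x'' (Inc (Reg ''x''))))) Q s1 f1"
    if "I s1 f1" for s1 f1
  proof (rule wp_While[where I = I, OF that])
    fix s' f' assume "I s' f'" and lt: "eval_test (Less (Reg ''x'') (Read ''off'' (Inc ue))) s'"
    then obtain j where j: "j \<le> length (L ! u)" "arr s' = arr s"
      "\<forall>y. y \<noteq> ''x'' \<longrightarrow> y \<noteq> ''d'' \<longrightarrow> reg s' y = reg s y" "reg s' ''x'' = offset u + j"
      "reg s' ''d'' = length (filter P (take j (L ! u)))" "f \<le> f' + 20 + 50 * j"
      unfolding I_def by blast
    have jl: "j < length (L ! u)" using lt off ev[OF j(2,3)] j by simp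
    have bb: "eval_test b s' \<longleftrightarrow> P (L ! u ! j)" using b[of s' j] j jl by blast
    have f': "60 + 10 \<le> f'" using f j(6) jl by simp
    show "1 + test_cost (Less (Reg ''x'') (Read ''off'' (Inc ue))) \<le> f' \<and>
      wp (Seq (IfElse b (Assign ''d'' (Inc (Reg ''d''))) Skip) (Assign ''x'' (Inc (Reg ''x'')))) I s'
        (f' - (1 + test_cost (Less (Reg ''x'') (Read ''off'' (Inc ue)))))"
      using cost f' bb j jl unfolding I_def
      by (cases "P (L ! u ! j)") (simp_all add: take_Suc_conv_app_nth, linarith+)
  next
    fix s' f' assume "I s' f'" and lt: "\<not> eval_test (Less (Reg ''x'') (Read ''off'' (Inc ue))) s'"
    then obtain j where j: "j \<le> length (L ! u)" "arr s' = arr s"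
      "\<forall>y. y \<noteq> ''x'' \<longrightarrow> y \<noteq> ''d'' \<longrightarrow> reg s' y = reg s y" "reg s' ''x'' = offset u + j"
      "reg s' ''d'' = length (filter P (take j (L ! u)))" "f \<le> f' + 20 + 50 * j"
      unfolding I_def by blast
    have jl: "j = length (L ! u)" using lt off ev[OF j(2,3)] j by simp
    have "Q s' (f' - (1 + test_cost (Less (Reg ''x'') (Read ''off'' (Inc ue)))))"
    proof (rule Q)
      show "reg s' y = reg s y" if "y \<noteq> ''x''" "y \<noteq> ''d''" for y using j(3) that by blast
      show "f \<le> f' - (1 + test_cost (Less (Reg ''x'') (Read ''off'' (Inc ue))))
          + 60 * (length (L ! u) + 1)"
        using j(6) jl cost f by simp
    qed (use j jl in simp_all)
    then show "1 + test_cost (Less (Reg ''x'') (Read ''off'' (Inc ue))) \<le> f' \<and>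
      Q s' (f' - (1 + test_cost (Less (Reg ''x'') (Read ''off'' (Inc ue)))))"
      using j(6) jl cost f by simp
  qed
  show ?thesis unfolding count_prog_def
    using off ue[of s] cost f by (simp, intro conjI loop) (simp_all add: I_def)
qed

lemma wp_scan_prog:
  assumes st: "graph_stored s" and u: "arr s ''q'' (reg s ''h'') = u" "u < length L"
    and deg: "\<And>w. w < length L \<Longrightarrow> arr s ''e'' w = length (L ! w)" "arr s ''e'' (length L) = length L"
    and f: "80 * (length (L ! u) + 1) \<le> f"
    and Q: "\<And>s' f'. arr s' = arr s \<Longrightarrow> (\<And>y. y \<noteq> ''x'' \<Longrightarrow> y \<noteq> ''b'' \<Longrightarrow> reg s' y = reg s y) \<Longrightarrow>
      reg s' ''b'' = length L \<and> (\<forall>w\<in>nb u. arr s z w \<noteq> 0) \<or>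
      reg s' ''b'' \<in> nb u \<and> arr s z (reg s' ''b'') = 0 \<and>
        (\<forall>w\<in>nb u. arr s z w = 0 \<longrightarrow> length (L ! reg s' ''b'') \<le> length (L ! w)) \<Longrightarrow>
      f \<le> f' + 80 * (length (L ! u) + 1) \<Longrightarrow> Q s' f'"
  shows "wp (scan_prog z) Q s f"
proof -
  \<comment> \<open>The goal of the scan, relative to the set \<open>X\<close> of list entries read
    so far.\<close>
  define R where "R = (\<lambda>b X. b = length L \<and> (\<forall>w\<in>X. arr s z w \<noteq> 0) \<or>
      b \<in> X \<and> arr s z b = 0 \<and> (\<forall>w\<in>X. arr s z w = 0 \<longrightarrow> length (L ! b) \<le> length (L ! w)))"
  define I where "I = (\<lambda>(s' :: state) f'. \<exists>j\<le>length (L ! u). arr s' = arr s \<and>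
    (\<forall>y. y \<noteq> ''x'' \<longrightarrow> y \<noteq> ''b'' \<longrightarrow> reg s' y = reg s y) \<and> reg s' ''x'' = offset u + j \<and>
    R (reg s' ''b'') (set (take j (L ! u))) \<and> f \<le> f' + 20 + 50 * j)"
  let ?T = "Less (Reg ''x'') (Read ''off'' (Inc (Read ''q'' (Reg ''h''))))"
  let ?B = "Conj (Equal (Read z (Read ''tgt'' (Reg ''x''))) (Const 0))
              (Less (Read ''e'' (Read ''tgt'' (Reg ''x''))) (Read ''e'' (Reg ''b'')))"
  have off: "arr s ''off'' u = offset u" "arr s ''off'' (Suc u) = offset u + length (L ! u)"
    using st u offset_Suc[OF u(2)] by (auto simp: graph_stored_def)
  have loop: "wp (While ?T
      (Seq (IfElse ?B (Assign ''b'' (Read ''tgt'' (Reg ''x''))) Skip)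
        (Assign ''x'' (Inc (Reg ''x''))))) Q s1 f1"
    if "I s1 f1" for s1 f1
  proof (rule wp_While[where I = I, OF that])
    fix s' f' assume "I s' f'" and lt: "eval_test ?T s'"
    then obtain j where j: "j \<le> length (L ! u)" "arr s' = arr s"
      "\<forall>y. y \<noteq> ''x'' \<longrightarrow> y \<noteq> ''b'' \<longrightarrow> reg s' y = reg s y" "reg s' ''x'' = offset u + j"
      "R (reg s' ''b'') (set (take j (L ! u)))" "f \<le> f' + 20 + 50 * j"
      unfolding I_def by blast
    have jl: "j < length (L ! u)" using lt off u j by simp
    define w where "w = L ! u ! j"
    have tg: "arr s ''tgt'' (offset u + j) = w" using st u jl by (simp add: graph_stored_def w_def)
    have w: "w < length L" using L_less u jl by (simp add: w_def)
    have sub: "\<And>v. v \<in> set (take j (L ! u)) \<Longrightarrow> v < length L"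
      using L_less u(2) in_set_takeD by metis
    have dw: "arr s ''e'' w = length (L ! w)" using deg w by simp
    have tk: "set (take (Suc j) (L ! u)) = insert w (set (take j (L ! u)))"
      using jl by (simp add: take_Suc_conv_app_nth w_def)
    define X where "X = set (take j (L ! u))"
    define b where "b = reg s' ''b''"
    have Rb: "R b X" using j(5) by (simp add: X_def b_def)
    have R1: "R w (insert w X)" if "arr s z w = 0" "length (L ! w) < arr s ''e'' b"
    proof -
      have "length (L ! w) \<le> length (L ! v)" if v: "v \<in> X" "arr s z v = 0" for v
      proof (cases "b = length L \<and> (\<forall>v\<in>X. arr s z v \<noteq> 0)")
        case False
        then have "b \<in> X" "length (L ! b) \<le> length (L ! v)" using Rb v unfolding R_def by blast+
        then show ?thesis
          using \<open>length (L ! w) < arr s ''e'' b\<close> deg(1)[OF sub] X_def by fastforce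
      qed (use v in auto)
      then show ?thesis using that by (simp add: R_def)
    qed
    have R2: "R b (insert w X)" if "\<not> (arr s z w = 0 \<and> length (L ! w) < arr s ''e'' b)"
    proof (cases "b = length L \<and> (\<forall>v\<in>X. arr s z v \<noteq> 0)")
      case True
      \<comment> \<open>Against the sentinel the degree comparison always succeeds, because degrees
        are below \<open>length L\<close>; the test can only have failed because \<open>w\<close> is
        visited.\<close>
      then have "arr s z w \<noteq> 0" using that deg(2) L_length_less[OF w] by auto
      then show ?thesis using True by (simp add: R_def)
    next
      case False
      then have bX: "b \<in> X" "arr s z b = 0"
        "\<forall>v\<in>X. arr s z v = 0 \<longrightarrow> length (L ! b) \<le> length (L ! v)"
        using Rb unfolding R_def by blast+
      then have "arr s ''e'' b = length (L ! b)" using deg(1) sub X_def by blast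
      then show ?thesis using bX that by (auto simp: R_def)
    qed
    have f': "60 + 10 \<le> f'" using f j(6) jl by simp
    show "1 + test_cost ?T \<le> f' \<and>
      wp (Seq (IfElse ?B (Assign ''b'' (Read ''tgt'' (Reg ''x''))) Skip)
        (Assign ''x'' (Inc (Reg ''x'')))) I s' (f' - (1 + test_cost ?T))"
      using f' j jl tg dw R1 R2
      by (cases "arr s z w = 0 \<and> length (L ! w) < arr s ''e'' b")
        (simp_all add: I_def tk X_def[symmetric] b_def[symmetric], linarith+)
  next
    fix s' f' assume "I s' f'" and lt: "\<not> eval_test ?T s'"
    then obtain j where j: "j \<le> length (L ! u)" "arr s' = arr s"
      "\<forall>y. y \<noteq> ''x'' \<longrightarrow> y \<noteq> ''b'' \<longrightarrow> reg s' y = reg s y" "reg s' ''x'' = offset u + j"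
      "R (reg s' ''b'') (set (take j (L ! u)))" "f \<le> f' + 20 + 50 * j"
      unfolding I_def by blast
    have jl: "j = length (L ! u)" using lt off u j by simp
    have "Q s' (f' - (1 + test_cost ?T))"
    proof (rule Q)
      show "reg s' y = reg s y" if "y \<noteq> ''x''" "y \<noteq> ''b''" for y using j(3) that by blast
      have "R (reg s' ''b'') (nb u)" using j(5) jl by (simp add: nb_def)
      then show "reg s' ''b'' = length L \<and> (\<forall>w\<in>nb u. arr s z w \<noteq> 0) \<or>
        reg s' ''b'' \<in> nb u \<and> arr s z (reg s' ''b'') = 0 \<and>
        (\<forall>w\<in>nb u. arr s z w = 0 \<longrightarrow> length (L ! reg s' ''b'') \<le> length (L ! w))"
        by (simp only: R_def)
      show "f \<le> f' - (1 + test_cost ?T) + 80 * (length (L ! u) + 1)"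
        using j(6) jl f by simp
    qed (use j in simp)
    then show "1 + test_cost ?T \<le> f' \<and> Q s' (f' - (1 + test_cost ?T))"
      using j jl f by simp
  qed
  show ?thesis unfolding scan_prog_def
    using off u st f by (simp add: graph_stored_def, intro conjI loop) (simp_all add: I_def R_def)
qed

end

section \<open>Lists and positions in arrays\<close>

definition stores :: "(nat \<Rightarrow> nat) \<Rightarrow> nat list \<Rightarrow> bool" where
  "stores g xs \<longleftrightarrow> (\<forall>x<length xs. g x = xs ! x)"

text \<open>Positions are stored plus one, so that \<open>0\<close> marks the vertices outside the list.\<close>

definition positions :: "nat \<Rightarrow> (nat \<Rightarrow> nat) \<Rightarrow> nat list \<Rightarrow> bool" where
  "positions n g xs \<longleftrightarrow>
     (\<forall>x<length xs. g (xs ! x) = Suc x) \<and> (\<forall>w<n. w \<notin> set xs \<longrightarrow> g w = 0)"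

lemma stores_append: "stores g xs \<Longrightarrow> stores (g(length xs := b)) (xs @ [b])"
  by (auto simp: stores_def nth_append)

lemma stores_replace_last:
  "stores g xs \<Longrightarrow> xs \<noteq> [] \<Longrightarrow> stores (g(length xs - Suc 0 := b)) (butlast xs @ [b])"
  by (auto simp: stores_def nth_append nth_butlast)

lemma positions_append:
  "positions n g xs \<Longrightarrow> b \<notin> set xs \<Longrightarrow> positions n (g(b := Suc (length xs))) (xs @ [b])"
  by (auto simp: positions_def nth_append)

lemma positions_zero_iff: "positions n g xs \<Longrightarrow> w < n \<Longrightarrow> g w = 0 \<longleftrightarrow> w \<notin> set xs"
  by (auto simp: positions_def in_set_conv_nth)

context adjacency_input
begin

lemma graph_stored_cong:
  assumes "graph_stored s" "arr s' ''off'' = arr s ''off''" "arr s' ''tgt'' = arr s ''tgt''"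
    "reg s' ''n'' = reg s ''n''"
  shows "graph_stored s'"
  using assms by (simp add: graph_stored_def)

definition degrees_stored :: "state \<Rightarrow> bool" where
  "degrees_stored s \<longleftrightarrow> (\<forall>w<length L. arr s ''e'' w = length (L ! w)) \<and>
     arr s ''e'' (length L) = length L"

lemma wp_degree_prog:
  assumes st: "graph_stored s" and f: "100 * (length L + 1) * (D + 1) \<le> f"
    and Q: "\<And>s' f'. (\<And>a. a \<noteq> ''e'' \<Longrightarrow> a \<noteq> ''a'' \<Longrightarrow> arr s' a = arr s a) \<Longrightarrow>
      (\<And>y. y \<noteq> ''x'' \<Longrightarrow> y \<noteq> ''d'' \<Longrightarrow> y \<noteq> ''u'' \<Longrightarrow> reg s' y = reg s y) \<Longrightarrow>
      degrees_stored s' \<Longrightarrow> stores (arr s' ''a'') [0..<length L] \<Longrightarrow>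
      f \<le> f' + 100 * (length L + 1) * (D + 1) \<Longrightarrow> Q s' f'"
  shows "wp degree_prog Q s f"
proof -
  \<comment> \<open>The allowance for one vertex: at most \<open>60 * (D + 1)\<close> for counting
    its list and 40 for everything else.\<close>
  define W where "W = 100 * (D + 1)"
  define I where "I = (\<lambda>(s' :: state) f'. \<exists>u\<le>length L.
    (\<forall>a. a \<noteq> ''e'' \<longrightarrow> a \<noteq> ''a'' \<longrightarrow> arr s' a = arr s a) \<and>
    (\<forall>y. y \<noteq> ''x'' \<longrightarrow> y \<noteq> ''d'' \<longrightarrow> y \<noteq> ''u'' \<longrightarrow> reg s' y = reg s y) \<and> reg s' ''u'' = u \<and>
    (\<forall>w<u. arr s' ''e'' w = length (L ! w)) \<and> (\<forall>w<u. arr s' ''a'' w = w) \<and>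
    f \<le> f' + 10 + u * W)"
  have W: "100 \<le> W" by (simp add: W_def)
  have fW: "length L * W + W \<le> f" using f by (simp add: W_def algebra_simps)
  let ?T = "Less (Reg ''u'') (Reg ''n'')"
  let ?R = "Seq (Write ''e'' (Reg ''u'') (Reg ''d''))
      (Seq (Write ''a'' (Reg ''u'') (Reg ''u'')) (Assign ''u'' (Inc (Reg ''u''))))"
  let ?E = "Write ''e'' (Reg ''n'') (Reg ''n'')"
  have loop: "wp (While ?T (Seq (count_prog (Reg ''u'') (Equal (Const 0) (Const 0))) ?R))
      (wp ?E Q) s1 f1" if "I s1 f1" for s1 f1
  proof (rule wp_While[where I = I, OF that])
    fix s' f' assume "I s' f'" and lt: "eval_test ?T s'"
    then obtain u where u: "u \<le> length L" "\<forall>a. a \<noteq> ''e'' \<longrightarrow> a \<noteq> ''a'' \<longrightarrow> arr s' a = arr s a"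
      "\<forall>y. y \<noteq> ''x'' \<longrightarrow> y \<noteq> ''d'' \<longrightarrow> y \<noteq> ''u'' \<longrightarrow> reg s' y = reg s y" "reg s' ''u'' = u"
      "\<forall>w<u. arr s' ''e'' w = length (L ! w)" "\<forall>w<u. arr s' ''a'' w = w"
      "f \<le> f' + 10 + u * W"
      unfolding I_def by blast
    have st': "graph_stored s'" by (rule graph_stored_cong[OF st]) (use u in simp_all)
    then have ul: "u < length L" using lt u by (simp add: graph_stored_def)
    then have "Suc u * W \<le> length L * W" by (intro mult_right_mono) simp_all
    then have f': "W + W \<le> f' + 10" using u(7) fW by simp
    have DW: "60 * (length (L ! u) + 1) + 40 \<le> W" using L_length[OF ul] by (simp add: W_def)
    have "wp (count_prog (Reg ''u'') (Equal (Const 0) (Const 0))) (wp ?R I) s'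
      (f' - (1 + test_cost ?T))"
    proof (rule wp_count_prog[where P = "\<lambda>_. True", OF st' ul])
      fix s2 :: state and f2
      assume s2: "arr s2 = arr s'" "\<And>y. y \<noteq> ''x'' \<Longrightarrow> y \<noteq> ''d'' \<Longrightarrow> reg s2 y = reg s' y"
        "reg s2 ''d'' = length (filter (\<lambda>_. True) (L ! u))"
        "f' - (1 + test_cost ?T) \<le> f2 + 60 * (length (L ! u) + 1)"
      have r: "reg s2 ''u'' = u" "reg s2 ''d'' = length (L ! u)" using s2(2)[of "''u''"] s2(3) u by simp_all
      have fr: "\<forall>y. y \<noteq> ''x'' \<longrightarrow> y \<noteq> ''d'' \<longrightarrow> y \<noteq> ''u'' \<longrightarrow> reg s2 y = reg s y"
        using s2(2) u(3) by simp
      have f2: "f' \<le> f2 + 4 + 60 * (length (L ! u) + 1)" "20 \<le> f2"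
        using s2(4) f' DW W by auto
      show "wp ?R I s2 f2"
        using r fr f2 ul u DW W unfolding I_def
        by (simp add: s2(1) less_Suc_eq) linarith
    qed (use u f' DW in \<open>simp_all\<close>)
    then show "1 + test_cost ?T \<le> f' \<and>
        wp (Seq (count_prog (Reg ''u'') (Equal (Const 0) (Const 0))) ?R) I s' (f' - (1 + test_cost ?T))"
      using f' W by simp
  next
    fix s' f' assume "I s' f'" and lt: "\<not> eval_test ?T s'"
    then obtain u where u: "u \<le> length L" "\<forall>a. a \<noteq> ''e'' \<longrightarrow> a \<noteq> ''a'' \<longrightarrow> arr s' a = arr s a"
      "\<forall>y. y \<noteq> ''x'' \<longrightarrow> y \<noteq> ''d'' \<longrightarrow> y \<noteq> ''u'' \<longrightarrow> reg s' y = reg s y" "reg s' ''u'' = u"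
      "\<forall>w<u. arr s' ''e'' w = length (L ! w)" "\<forall>w<u. arr s' ''a'' w = w"
      "f \<le> f' + 10 + u * W"
      unfolding I_def by blast
    have n: "reg s' ''n'' = length L" using u(3) st by (simp add: graph_stored_def)
    have ul: "u = length L" using lt u n by simp
    have f': "W \<le> f' + 10" "f \<le> f' + 10 + length L * W" using u(7) fW ul by simp_all
    have "Q (s'\<lparr>arr := (arr s')(''e'' := (arr s' ''e'')(length L := length L))\<rparr>) (f' - 7)"
    proof (rule Q)
      show "f \<le> f' - 7 + 100 * (length L + 1) * (D + 1)"
        using f' W by (simp add: W_def algebra_simps)
    qed (use u ul in \<open>simp_all add: degrees_stored_def stores_def\<close>)
    then show "1 + test_cost ?T \<le> f' \<and> wp ?E Q s' (f' - (1 + test_cost ?T))"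
      using f' W n by (simp add: eval_nat_numeral)
  qed
  show ?thesis unfolding degree_prog_def
    using fW W by (simp, intro conjI loop) (simp_all add: I_def)
qed

end

section \<open>One search pass as a program\<close>

locale search_names =
  fixes src dst z :: string
  assumes names: "src \<noteq> ''q''" "dst \<notin> {''q'', ''off'', ''tgt'', ''e''}"
    "z \<notin> {''q'', ''off'', ''tgt'', ''e''}" "src \<noteq> dst" "src \<noteq> z" "dst \<noteq> z"

locale search_program = adjacency_input L D + search_names src dst z
  for L D src dst z +
  fixes src_list :: "nat list" and s0 :: state
  assumes stored: "graph_stored s0" "degrees_stored s0" "stores (arr s0 src) src_list"
    and src_less: "set src_list \<subseteq> {..<length L}"
    and src_length: "reg s0 ''l'' = length src_list"
begin

text \<open>The bound \<open>length S \<le> i\<close> limits the number of starts, which is the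
  number of candidates of the next pass. That \<open>S\<close> is nonempty once \<open>Q\<close> is
  makes \<open>j - 1\<close> the index of its last entry instead of a truncated difference.\<close>

definition represents :: "state \<Rightarrow> nat \<times> nat list \<times> nat \<times> bool \<times> nat list \<Rightarrow> bool" where
  "represents s = (\<lambda>(i, Q, h, fl, S).
     (\<forall>a. a \<notin> {''q'', z, dst} \<longrightarrow> arr s a = arr s0 a) \<and>
     (\<forall>y. y \<notin> {''i'', ''m'', ''h'', ''j'', ''f'', ''x'', ''b'', ''v''} \<longrightarrow> reg s y = reg s0 y) \<and>
     reg s ''i'' = i \<and> reg s ''m'' = length Q \<and> reg s ''h'' = h \<and> reg s ''j'' = length S \<and>
     reg s ''f'' = (if fl then 1 else 0) \<and>
     stores (arr s ''q'') Q \<and> positions (length L) (arr s z) Q \<and> stores (arr s dst) S \<and>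
     length S \<le> i \<and> i \<le> length src_list \<and> (Q \<noteq> [] \<longrightarrow> S \<noteq> []) \<and>
     distinct Q \<and> set Q \<subseteq> {..<length L} \<and> h \<le> length Q)"

lemma card_nb: "u < length L \<Longrightarrow> card (nb u) = length (L ! u)"
  by (simp add: nb_def L_distinct distinct_card)

text \<open>The refinement step: each iteration realizes one abstract step at the price of at most
  one list scan, so that the running time of a pass reduces to counting steps.\<close>

lemma wp_search_body:
  assumes rep: "represents s (i, Q, h, fl, S)" and more: "h < length Q \<or> i < length src_list"
    and f: "200 * (D + 1) \<le> f"
  shows "wp (search_body src dst z)
    (\<lambda>s' f'. \<exists>x. search_step nb src_list (i, Q, h, fl, S) x \<and> represents s' x \<and>
      f \<le> f' + 150 * (D + 1)) s f"
proof -
  define W where "W = 150 * (D + 1)"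
  define R where "R = (\<lambda>s' f'. \<exists>x. search_step nb src_list (i, Q, h, fl, S) x \<and>
      represents s' x \<and> f \<le> f' + 150 * (D + 1))"
  have R: "R s' f'" if "search_step nb src_list (i, Q, h, fl, S) x" "represents s' x"
    "f \<le> f' + W" for s' f' x
    using that unfolding R_def W_def by blast
  note r = rep[unfolded represents_def prod.case]
  have nm: "''q'' \<noteq> z" "z \<noteq> ''q''" "''q'' \<noteq> dst" "dst \<noteq> ''q''" "z \<noteq> dst" "dst \<noteq> z"
    "src \<noteq> ''q''" "src \<noteq> z" "src \<noteq> dst" using names by auto
  have fr: "arr s a = arr s0 a" if "a \<noteq> ''q''" "a \<noteq> z" "a \<noteq> dst" for a
    using r that by blast
  have frr: "reg s ''n'' = length L"
    using r stored(1) by (simp add: graph_stored_def)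
  have arrs: "arr s ''off'' = arr s0 ''off''" "arr s ''tgt'' = arr s0 ''tgt''" "arr s ''e'' = arr s0 ''e''"
    "arr s src = arr s0 src" using fr names by auto
  have gs: "graph_stored s"
    by (rule graph_stored_cong[OF stored(1)]) (use arrs frr stored(1) in \<open>simp_all add: graph_stored_def\<close>)
  have regs: "reg s ''i'' = i" "reg s ''m'' = length Q" "reg s ''h'' = h" "reg s ''j'' = length S"
     "reg s ''f'' = (if fl then 1 else 0)" using r by blast+
  have q: "stores (arr s ''q'') Q" and zp: "positions (length L) (arr s z) Q"
    and ds: "stores (arr s dst) S" using r by blast+
  have Qd: "distinct Q" "set Q \<subseteq> {..<length L}" "h \<le> length Q" "Q \<noteq> [] \<longrightarrow> S \<noteq> []"
    "length S \<le> i" "i \<le> length src_list" using r by blast+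
  have "wp (search_body src dst z) R s f"
  proof (cases "h < length Q")
    case True
    define u where "u = Q ! h"
    have u: "u < length L" using Qd(2) True nth_mem unfolding u_def by blast
    have qu: "arr s ''q'' (reg s ''h'') = u" using q True regs by (simp add: stores_def u_def)
    have lu: "length (L ! u) \<le> D" by (rule L_length[OF u])
    let ?P = "IfElse (Less (Reg ''b'') (Reg ''n''))
          (Seq (Write ''q'' (Reg ''m'') (Reg ''b''))
          (Seq (Assign ''m'' (Inc (Reg ''m'')))
          (Seq (Write z (Reg ''b'') (Reg ''m''))
          (IfElse (Equal (Reg ''f'') (Const 0))
            (Seq (Write dst (Dec (Reg ''j'')) (Reg ''b'')) (Assign ''f'' (Const 1)))
            Skip))))
          (Seq (Assign ''h'' (Inc (Reg ''h''))) (Assign ''f'' (Const 0)))"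
    have zn: "arr s z w = 0 \<longleftrightarrow> w \<notin> set Q" if "w \<in> nb u" for w
      by (rule positions_zero_iff[OF zp]) (use L_less u that in \<open>auto simp: nb_def\<close>)
    have "wp (scan_prog z) (wp ?P R) s (f - 4)"
    proof (rule wp_scan_prog[OF gs qu u])
      show "arr s ''e'' w = length (L ! w)" if "w < length L" for w
        using stored(2) arrs that by (simp add: degrees_stored_def)
      show "arr s ''e'' (length L) = length L"
        using stored(2) arrs by (simp add: degrees_stored_def)
      show "80 * (length (L ! u) + 1) \<le> f - 4" using f lu by simp
    next
      fix s' :: state and f'
      assume s': "arr s' = arr s" "\<And>y. y \<noteq> ''x'' \<Longrightarrow> y \<noteq> ''b'' \<Longrightarrow> reg s' y = reg s y"
        and b: "reg s' ''b'' = length L \<and> (\<forall>w\<in>nb u. arr s z w \<noteq> 0) \<or>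
          reg s' ''b'' \<in> nb u \<and> arr s z (reg s' ''b'') = 0 \<and>
          (\<forall>w\<in>nb u. arr s z w = 0 \<longrightarrow> length (L ! reg s' ''b'') \<le> length (L ! w))"
        and f': "f - 4 \<le> f' + 80 * (length (L ! u) + 1)"
      have f1: "100 \<le> f'" "f + 50 \<le> f' + 150 * (D + 1)" using f' f lu by simp_all
      \<comment> \<open>With the credit written as a sum, the truncated subtractions of the
        operations to come cancel by simplification.\<close>
      obtain g where g: "f' = g + 30" using f1(1) by (intro that[of "f' - 30"]) simp
      have fg: "f \<le> g + W" using f1(2) g by (simp add: W_def)
      have regs': "reg s' ''i'' = i" "reg s' ''m'' = length Q" "reg s' ''h'' = h"
        "reg s' ''j'' = length S" "reg s' ''f'' = (if fl then 1 else 0)" "reg s' ''n'' = length L"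
        using s'(2) regs frr by simp_all
      have frr': "\<forall>y. y \<notin> {''i'', ''m'', ''h'', ''j'', ''f'', ''x'', ''b'', ''v''} \<longrightarrow> reg s' y = reg s0 y"
        using s'(2) r by simp
      show "wp ?P R s' f'"
      proof (cases "reg s' ''b'' = length L")
        case bn: True
        then have "length L \<notin> nb u" using L_less u by (auto simp: nb_def)
        then have "\<forall>w\<in>nb u. arr s z w \<noteq> 0" using b bn by auto
        then have sub: "nb (Q ! h) \<subseteq> set Q" using zn unfolding u_def by blast
        have "represents (s'\<lparr>reg := (reg s')(''h'' := Suc h, ''f'' := 0)\<rparr>) (i, Q, Suc h, False, S)"
          unfolding represents_def using regs' frr' s'(1) q zp ds Qd True fr
          by simp
        moreover have "search_step nb src_list (i, Q, h, fl, S) (i, Q, Suc h, False, S)"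
          by (rule search_step.advance) (use True sub in simp_all)
        ultimately show ?thesis
          using regs' bn fg by (simp add: g eval_nat_numeral, intro R) simp_all
      next
        case bn: False
        define w where "w = reg s' ''b''"
        have w: "w \<in> nb u" "w \<notin> set Q" "w < length L"
          "\<forall>v\<in>nb u - set Q. length (L ! w) \<le> length (L ! v)"
          using b bn zn L_less[OF u] unfolding w_def by (auto simp: nb_def)
        let ?S = "if fl then S else butlast S @ [w]"
        have "search_step nb src_list (i, Q, h, fl, S) (i, Q @ [w], h, True, ?S)"
        proof (rule search_step.append)
          show "h < length Q" by (rule True)
          show "w \<in> nb (Q ! h) - set Q" using w by (simp add: u_def)
          show "\<forall>v\<in>nb (Q ! h) - set Q. card (nb w) \<le> card (nb v)"
            using w card_nb L_less[OF u] unfolding u_def nb_def by auto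
        qed
        moreover have "S \<noteq> []" using Qd(4) True by auto
        moreover define s2 where "s2 = s'\<lparr>reg := (reg s')(''m'' := Suc (length Q)),
          arr := (arr s')(''q'' := (arr s ''q'')(length Q := w), z := (arr s z)(w := Suc (length Q)))\<rparr>"
        moreover have "represents (if fl then s2 else s2\<lparr>
            arr := (arr s2)(dst := (arr s dst)(length S - Suc 0 := w)), reg := (reg s2)(''f'' := 1)\<rparr>) (i, Q @ [w], h, True, ?S)"
          using regs' frr' s'(1) stores_append[OF q, of w] positions_append[OF zp w(2)]
            stores_replace_last[OF ds \<open>S \<noteq> []\<close>, of w] ds Qd True fr nm w(2,3) \<open>S \<noteq> []\<close>
          unfolding represents_def s2_def
          by (cases fl) simp_all
        ultimately have R2: "R (if fl then s2 else s2\<lparr>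
            arr := (arr s2)(dst := (arr s dst)(length S - Suc 0 := w)), reg := (reg s2)(''f'' := 1)\<rparr>) g"
          if "f \<le> g + W" for g
          using R that by blast
        show ?thesis
        proof (cases fl)
          case True
          then show ?thesis
            using regs' fg w(3) nm s'(1) R2
            by (simp add: g w_def[symmetric] s2_def eval_nat_numeral)
        next
          case False
          then show ?thesis
            using regs' fg w(3) nm s'(1) R2
            by (simp add: g w_def[symmetric] s2_def eval_nat_numeral)
        qed
      qed
    qed
    moreover have "4 \<le> f" using f by simp
    ultimately show ?thesis unfolding search_body_def using True regs
      by (simp add: eval_nat_numeral)
  next
    case False
    then have h: "h = length Q" "i < length src_list" using Qd more by auto
    define w where "w = src_list ! i"
    have w: "w < length L" using src_less h nth_mem unfolding w_def by blast
    have sw: "arr s src i = w" using stored(3) h arrs by (simp add: stores_def w_def)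
    have zw: "arr s z w = 0 \<longleftrightarrow> w \<notin> set Q" by (rule positions_zero_iff[OF zp w])
    have frr': "\<forall>y. y \<notin> {''i'', ''m'', ''h'', ''j'', ''f'', ''x'', ''b'', ''v''} \<longrightarrow> reg s y = reg s0 y"
      using r by blast
    obtain g where g: "f = g + 40" using f by (intro that[of "f - 40"]) simp
    have fg: "f \<le> g + W" using f g by (simp add: W_def)
    show ?thesis
    proof (cases "w \<in> set Q")
      case wQ: True
      have "represents (s\<lparr>reg := (reg s)(''v'' := w, ''i'' := Suc i)\<rparr>) (Suc i, Q, h, fl, S)"
        unfolding represents_def using regs frr' q zp ds Qd h fr by simp
      moreover have "search_step nb src_list (i, Q, h, fl, S) (Suc i, Q, h, fl, S)"
        by (rule search_step.skip) (use h wQ in \<open>simp_all add: w_def\<close>)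
      ultimately have "R (s\<lparr>reg := (reg s)(''v'' := w, ''i'' := Suc i)\<rparr>) g"
        if "f \<le> g + W" for g
        using R that by blast
      then show ?thesis unfolding search_body_def
        using regs fg False sw wQ zw by (simp add: g eval_nat_numeral)
    next
      case wQ: False
      have "represents (s\<lparr>arr := (arr s)(''q'' := (arr s ''q'')(length Q := w),
            z := (arr s z)(w := Suc (length Q)), dst := (arr s dst)(length S := w)),
          reg := (reg s)(''v'' := w, ''i'' := Suc i, ''m'' := Suc (length Q), ''f'' := 0,
            ''j'' := Suc (length S))\<rparr>)
          (Suc i, Q @ [w], h, False, S @ [w])"
        unfolding represents_def
        using regs frr' stores_append[OF q, of w] positions_append[OF zp wQ]
            stores_append[OF ds, of w] Qd h fr nm w wQ by simp
      moreover have "search_step nb src_list (i, Q, h, fl, S) (Suc i, Q @ [w], h, False, S @ [w])"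
        unfolding w_def by (rule search_step.start) (use h wQ in \<open>simp_all add: w_def\<close>)
      ultimately have "R (s\<lparr>arr := (arr s)(''q'' := (arr s ''q'')(length Q := w),
            z := (arr s z)(w := Suc (length Q)), dst := (arr s dst)(length S := w)),
          reg := (reg s)(''v'' := w, ''i'' := Suc i, ''m'' := Suc (length Q), ''f'' := 0,
            ''j'' := Suc (length S))\<rparr>) g"
        if "f \<le> g + W" for g
        using R that by blast
      then show ?thesis unfolding search_body_def
        using regs fg False sw wQ zw nm by (simp add: g eval_nat_numeral)
    qed
  qed
  then show ?thesis by (simp only: R_def)
qed

text \<open>Every step queues a vertex, exhausts an entry or consumes a candidate, so the potential
  \<open>pot\<close> drops; it starts at no more than three times the number of vertices. One unit
  of it is worth \<open>V\<close>, which covers the body at \<open>150 * (D + 1)\<close> and the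
  guard at 11.\<close>

lemma wp_search_prog:
  assumes z: "\<forall>w<length L. arr s0 z w = 0" and len: "length src_list \<le> length L"
    and f: "800 * (length L + 1) * (D + 1) \<le> f"
    and Q: "\<And>s' f' Q fl S. represents s' (length src_list, Q, length Q, fl, S) \<Longrightarrow>
      (search_step nb src_list)\<^sup>*\<^sup>* (0, [], 0, False, []) (length src_list, Q, length Q, fl, S) \<Longrightarrow>
      f \<le> f' + 800 * (length L + 1) * (D + 1) \<Longrightarrow> R s' f'"
  shows "wp (search_prog src dst z) R s0 f"
proof -
  define V where "V = 170 * (D + 1)"
  define pot where "pot = (\<lambda>(i, Q :: nat list, h, fl :: bool, S :: nat list).
    (length L - length Q) + (length L - h) + (length src_list - i))"
  let ?x0 = "(0, [], 0, False, []) :: nat \<times> nat list \<times> nat \<times> bool \<times> nat list"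
  have V: "170 \<le> V" by (simp add: V_def)
  have pot0: "pot ?x0 * V \<le> 3 * (length L * V)"
    using mult_right_mono[of "pot ?x0" "3 * length L" V] len by (simp add: pot_def)
  have fV: "4 * (length L * V) + 4 * V \<le> f" using f by (simp add: V_def algebra_simps)
  have lenQ: "length Q \<le> length L" "h \<le> length L" "i \<le> length src_list" "h \<le> length Q"
    if "represents s' (i, Q, h, fl, S)" for s' i Q h fl S
  proof -
    have "distinct Q" "set Q \<subseteq> {..<length L}" "h \<le> length Q" "i \<le> length src_list"
      using that unfolding represents_def prod.case by blast+
    moreover from this have "card (set Q) \<le> length L" using card_mono[of "{..<length L}"] by simp
    ultimately show "length Q \<le> length L" "h \<le> length L" "i \<le> length src_list" "h \<le> length Q"
      by (simp_all add: distinct_card)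
  qed
  have pot_step: "Suc (pot y) \<le> pot x"
    if "search_step nb src_list x y" "represents s' y" for x y s'
    using that
  proof (induction rule: search_step.induct)
    case (append h Q w i fl S)
    from lenQ[OF append(4)] show ?case by (simp add: pot_def)
  next
    case (advance h Q i f S)
    from lenQ[OF advance(3)] show ?case by (simp add: pot_def)
  next
    case (skip h Q i f S)
    from lenQ[OF skip(4)] show ?case by (simp add: pot_def)
  next
    case (start h Q i f S)
    from lenQ[OF start(4)] show ?case using start(1,2) by (simp add: pot_def)
  qed
  define I where "I = (\<lambda>s' f'. \<exists>x. (search_step nb src_list)\<^sup>*\<^sup>* ?x0 x \<and> represents s' x \<and>
    f + pot x * V \<le> f' + pot ?x0 * V + 20)"
  let ?T = "Neg (Conj (Neg (Less (Reg ''h'') (Reg ''m''))) (Neg (Less (Reg ''i'') (Reg ''l''))))"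
  have regs: "reg s' ''h'' = h" "reg s' ''m'' = length Q" "reg s' ''i'' = i"
    "reg s' ''l'' = length src_list"
    if "represents s' (i, Q, h, fl, S)" for s' i Q h fl S
  proof -
    show "reg s' ''h'' = h" "reg s' ''m'' = length Q" "reg s' ''i'' = i"
      using that unfolding represents_def prod.case by blast+
    have "\<forall>y. y \<notin> {''i'', ''m'', ''h'', ''j'', ''f'', ''x'', ''b'', ''v''} \<longrightarrow> reg s' y = reg s0 y"
      using that unfolding represents_def prod.case by blast
    then show "reg s' ''l'' = length src_list" using src_length by simp
  qed
  have loop: "wp (While ?T (search_body src dst z)) R s1 f1" if "I s1 f1" for s1 f1
  proof (rule wp_While[where I = I, OF that])
    fix s' f' assume "I s' f'" and T: "eval_test ?T s'"
    then obtain i Q h fl S where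
      x: "(search_step nb src_list)\<^sup>*\<^sup>* ?x0 (i, Q, h, fl, S)" "represents s' (i, Q, h, fl, S)"
        "f + pot (i, Q, h, fl, S) * V \<le> f' + pot ?x0 * V + 20"
      unfolding I_def by (metis prod_cases5)
    have more: "h < length Q \<or> i < length src_list" using T regs[OF x(2)] by auto
    have f': "3 * V \<le> f'" using x(3) pot0 fV V by linarith
    have "wp (search_body src dst z) I s' (f' - 11)"
    proof -
      have "wp (search_body src dst z)
        (\<lambda>s2 f2. \<exists>y. search_step nb src_list (i, Q, h, fl, S) y \<and> represents s2 y \<and>
          f' - 11 \<le> f2 + 150 * (D + 1)) s' (f' - 11)"
        by (rule wp_search_body[OF x(2) more]) (use f' in \<open>simp add: V_def\<close>)
      moreover have "I s2 f2" if "search_step nb src_list (i, Q, h, fl, S) y" "represents s2 y"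
          "f' - 11 \<le> f2 + 150 * (D + 1)" for s2 f2 y
      proof -
        have "f' \<le> f2 + V" using that(3) f' V by (simp add: V_def)
        moreover have "V + pot y * V \<le> pot (i, Q, h, fl, S) * V"
          using mult_right_mono[OF pot_step[OF that(1,2)], of V] by simp
        ultimately have "f + pot y * V \<le> f2 + pot ?x0 * V + 20" using x(3) by linarith
        then show ?thesis unfolding I_def using that(1,2) x(1) rtranclp.rtrancl_into_rtrancl
          by metis
      qed
      ultimately show ?thesis unfolding wp_def by blast
    qed
    then show "1 + test_cost ?T \<le> f' \<and> wp (search_body src dst z) I s' (f' - (1 + test_cost ?T))"
      using f' V by (simp add: eval_nat_numeral)
  next
    fix s' f' assume "I s' f'" and T: "\<not> eval_test ?T s'"
    then obtain i Q h fl S where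
      x: "(search_step nb src_list)\<^sup>*\<^sup>* ?x0 (i, Q, h, fl, S)" "represents s' (i, Q, h, fl, S)"
        "f + pot (i, Q, h, fl, S) * V \<le> f' + pot ?x0 * V + 20"
      unfolding I_def by (metis prod_cases5)
    have e: "h = length Q" "i = length src_list" using T regs[OF x(2)] lenQ[OF x(2)] by auto
    have f': "V \<le> f'" "f \<le> f' + 3 * (length L * V) + 20" using x(3) pot0 fV V by linarith+
    have "R s' (f' - 11)"
    proof (rule Q)
      show "represents s' (length src_list, Q, length Q, fl, S)" using x e by simp
      show "(search_step nb src_list)\<^sup>*\<^sup>* ?x0 (length src_list, Q, length Q, fl, S)" using x e by simp
      have "f \<le> f' - 11 + 3 * (length L * V) + V" using f' V by linarith
      then show "f \<le> f' - 11 + 800 * (length L + 1) * (D + 1)" by (simp add: V_def algebra_simps)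
    qed
    then show "1 + test_cost ?T \<le> f' \<and> R s' (f' - (1 + test_cost ?T))"
      using f' V by (simp add: eval_nat_numeral)
  qed
  have rep0: "represents (s0\<lparr>reg := (reg s0)(''i'' := 0, ''m'' := 0, ''h'' := 0, ''j'' := 0, ''f'' := 0)\<rparr>) ?x0"
    using z by (simp add: represents_def stores_def positions_def)
  have "20 \<le> f" using fV V by linarith
  then obtain g where g: "f = g + 20" by (intro that[of "f - 20"]) simp
  have "I (s0\<lparr>reg := (reg s0)(''i'' := 0, ''m'' := 0, ''h'' := 0, ''j'' := 0, ''f'' := 0)\<rparr>) f'"
    if "g \<le> f'" for f'
    unfolding I_def by (rule exI[of _ ?x0]) (use rep0 that g in simp)
  then show ?thesis unfolding search_prog_def
    by (simp add: g eval_nat_numeral loop)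
qed

end

section \<open>The greedy scan as a program\<close>

locale greedy_program = adjacency_input L D + umbrella_order "adjacency_input.nb L" Q c
  for L D Q c +
  assumes set_Q: "set Q = {..<length L}"
begin

lemma length_Q: "length Q = length L"
  using distinct_card[OF distinct_Q] set_Q by simp

text \<open>The position array \<open>g\<close> increases along \<open>Q\<close>, so comparing its
  values separates right from left neighbors without any order on the adjacency lists.\<close>

lemma length_filter_right:
  assumes pos: "positions (length L) g Q" and i: "i < length Q"
  shows "length (filter (\<lambda>w. g (Q ! i) < g w) (L ! (Q ! i))) = rdeg i"
proof -
  have Qi: "Q ! i < length L" using i set_Q nth_mem by blast
  have g: "g (Q ! y) = Suc y" if "y < length Q" for y using pos that by (simp add: positions_def)
  have "length (filter (\<lambda>w. g (Q ! i) < g w) (L ! (Q ! i))) =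
      card {w \<in> nb (Q ! i). g (Q ! i) < g w}"
    using L_distinct[OF Qi] distinct_card[of "filter (\<lambda>w. g (Q ! i) < g w) (L ! (Q ! i))"]
    by (simp add: nb_def)
  also have "{w \<in> nb (Q ! i). g (Q ! i) < g w} =
      (!) Q ` {y. i < y \<and> y < length Q \<and> Q ! y \<in> nb (Q ! i)}" (is "?A = ?B")
  proof
    show "?A \<subseteq> ?B"
    proof
      fix w assume w: "w \<in> ?A"
      then have "w \<in> set Q" using L_less[OF Qi] set_Q by (auto simp: nb_def)
      then obtain y where "y < length Q" "w = Q ! y" by (metis in_set_conv_nth)
      then show "w \<in> ?B" using w g i by auto
    qed
    show "?B \<subseteq> ?A" using g i by auto
  qed
  also have "card \<dots> = rdeg i" unfolding rdeg_def
    using distinct_Q by (intro card_image) (auto simp: inj_on_def nth_eq_iff_index_eq)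
  finally show ?thesis .
qed

lemma wp_greedy_prog:
  assumes st: "graph_stored s" and regs: "reg s ''c'' = c" "reg s ''k'' = k"
    and q: "stores (arr s ''q'') Q" and z: "positions (length L) (arr s ''z'') Q"
    and f: "200 * (length L + 1) * (D + 1) \<le> f"
  shows "wp greedy_prog
    (\<lambda>s' f'. \<exists>P. greedy P \<and> (reg s' ''out'' = 1 \<longleftrightarrow> card P \<le> k)) s f"
proof -
  define R where "R = (\<lambda>(s' :: state) (f' :: nat). \<exists>P. greedy P \<and> (reg s' ''out'' = 1 \<longleftrightarrow> card P \<le> k))"
  define W where "W = 100 * (D + 1)"
  have W: "100 \<le> W" by (simp add: W_def)
  have fW: "length L * W + W + W \<le> f" using f by (simp add: W_def algebra_simps)
  define I where "I = (\<lambda>(s' :: state) f'. \<exists>i w P. i \<le> length L \<and> arr s' = arr s \<and>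
    (\<forall>y. y \<notin> {''x'', ''d'', ''i'', ''w'', ''r'', ''g''} \<longrightarrow> reg s' y = reg s y) \<and>
    reg s' ''i'' = i \<and> reg s' ''w'' = w \<and> reg s' ''r'' = card P \<and>
    reg s' ''g'' = (if 0 < i \<and> rdeg (i - 1) = c then 1 else 0) \<and>
    greedy_inv i w P \<and> f \<le> f' + 20 + i * W)"
  let ?T = "Less (Reg ''i'') (Reg ''n'')"
  let ?U = "Read ''q'' (Reg ''i'')"
  let ?B = "Less (Read ''z'' (Read ''q'' (Reg ''i''))) (Read ''z'' (Read ''tgt'' (Reg ''x'')))"
  let ?Rest = "Seq (IfElse (Equal (Reg ''w'') (Const 0))
        (IfElse (Conj (Equal (Reg ''g'') (Const 1)) (Equal (Reg ''d'') (Reg ''c'')))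
          (Seq (Assign ''r'' (Inc (Reg ''r''))) (Assign ''w'' (Inc (Reg ''c''))))
          Skip)
        (Assign ''w'' (Dec (Reg ''w''))))
    (Seq (IfElse (Equal (Reg ''d'') (Reg ''c'')) (Assign ''g'' (Const 1)) (Assign ''g'' (Const 0)))
      (Assign ''i'' (Inc (Reg ''i''))))"
  define E where "E = IfElse (Less (Reg ''k'') (Reg ''r'')) (Assign ''out'' (Const 0)) (Assign ''out'' (Const 1))"
  have loop: "wp (While ?T greedy_body) (wp E R) s1 f1" if "I s1 f1" for s1 f1
  proof (rule wp_While[where I = I, OF that])
    fix s' f' assume "I s' f'" and T: "eval_test ?T s'"
    then obtain i w P where i: "arr s' = arr s"
      "\<forall>y. y \<notin> {''x'', ''d'', ''i'', ''w'', ''r'', ''g''} \<longrightarrow> reg s' y = reg s y"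
      "reg s' ''i'' = i" "reg s' ''w'' = w" "reg s' ''r'' = card P"
      "reg s' ''g'' = (if 0 < i \<and> rdeg (i - 1) = c then 1 else 0)"
      "greedy_inv i w P" "f \<le> f' + 20 + i * W"
      unfolding I_def by (elim exE conjE) (rule that; assumption)
    have n: "reg s' ''n'' = length L" using i(2) st by (simp add: graph_stored_def)
    have il: "i < length L" using T n i by simp
    have iQ: "i < length Q" using il length_Q by simp
    define u where "u = Q ! i"
    have u: "u < length L" using iQ set_Q nth_mem unfolding u_def by blast
    have qi: "arr s ''q'' i = u" using q iQ by (simp add: stores_def u_def)
    have st': "graph_stored s'" by (rule graph_stored_cong[OF st]) (use i n st in \<open>simp_all add: graph_stored_def\<close>)
    have "Suc i * W \<le> length L * W" using il by (intro mult_right_mono) simp_all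
    then have f': "W + W + W \<le> f' + 20" using i(8) fW by simp
    have DW: "60 * (length (L ! u) + 1) + 40 \<le> W" using L_length[OF u] by (simp add: W_def)
    have "wp (count_prog ?U ?B) (wp ?Rest I) s' (f' - 4)"
    proof (rule wp_count_prog[where P = "\<lambda>v. arr s ''z'' u < arr s ''z'' v", OF st' u])
      fix s2 :: state and j
      assume "arr s2 = arr s'" "\<And>y. y \<noteq> ''x'' \<Longrightarrow> y \<noteq> ''d'' \<Longrightarrow> reg s2 y = reg s' y"
        "reg s2 ''x'' = offset u + j" "j < length (L ! u)"
      then show "eval_test ?B s2 \<longleftrightarrow> arr s ''z'' u < arr s ''z'' (L ! u ! j)"
        using i(1,3) qi st u by (simp add: graph_stored_def)
    next
      fix s2 :: state and f2
      assume s2: "arr s2 = arr s'" "\<And>y. y \<noteq> ''x'' \<Longrightarrow> y \<noteq> ''d'' \<Longrightarrow> reg s2 y = reg s' y"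
        "reg s2 ''d'' = length (filter (\<lambda>v. arr s ''z'' u < arr s ''z'' v) (L ! u))"
        "f' - 4 \<le> f2 + 60 * (length (L ! u) + 1)"
      have d: "reg s2 ''d'' = rdeg i" using s2(3) length_filter_right[OF z iQ] by (simp add: u_def)
      have fr: "\<forall>y. y \<notin> {''x'', ''d'', ''i'', ''w'', ''r'', ''g''} \<longrightarrow> reg s2 y = reg s y"
        using s2(2) i(2) by simp
      have r2: "reg s2 ''i'' = i" "reg s2 ''w'' = w" "reg s2 ''r'' = card P"
        "reg s2 ''g'' = (if 0 < i \<and> rdeg (i - 1) = c then 1 else 0)"
        using s2(2) i by simp_all
      have c2: "reg s2 ''c'' = c" using fr regs by simp
      have "60 \<le> f2" using s2(4) f' DW W by simp
      then obtain g where g: "f2 = g + 30" by (intro that[of "f2 - 30"]) simp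
      have fg: "f \<le> g + 20 + Suc i * W" using s2(4) i(8) g DW f' by simp
      have inv: "I s3 g'"
        if "arr s3 = arr s" "\<forall>y. y \<notin> {''x'', ''d'', ''i'', ''w'', ''r'', ''g''} \<longrightarrow> reg s3 y = reg s y"
          "reg s3 ''i'' = Suc i" "reg s3 ''r'' = card PP"
          "reg s3 ''g'' = (if rdeg i = c then 1 else 0)" "greedy_inv (Suc i) (reg s3 ''w'') PP" "g \<le> g'"
        for s3 g' PP
        unfolding I_def
        by (rule exI[of _ "Suc i"], rule exI[of _ "reg s3 ''w''"], rule exI[of _ PP])
          (use that il fg in simp)
      have bad: "bad (i - 1) \<longleftrightarrow> rdeg (i - 1) = c \<and> rdeg i = c" if "0 < i"
        using that iQ by (simp add: bad_def)
      \<comment> \<open>The window at \<open>i - 1\<close> is decided only now, because its badness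
        involves the right degree at \<open>i\<close>, just counted. The cases correspond to
        \<open>greedy_inv_select\<close>, \<open>greedy_inv_ignore\<close> and
        \<open>greedy_inv_wait\<close>.\<close>
      consider "w = 0" "0 < i" "bad (i - 1)" | "w = 0" "\<not> (0 < i \<and> bad (i - 1))"
        | w' where "w = Suc w'" by (cases w) blast+
      then show "wp ?Rest I s2 f2"
      proof cases
        case 1
        have gi: "greedy_inv (Suc i) (Suc c) (insert (i - 1) P)" "i - 1 \<notin> P"
          using greedy_inv_select[of "i - 1" P] 1 i(7) by simp_all
        moreover have "finite P" using i(7) by (simp add: greedy_inv_def)
        ultimately have "card (insert (i - 1) P) = Suc (card P)" by simp
        then show ?thesis
          using 1 bad d r2 c2 fr s2(1) i(1) gi(1)
          by (simp add: g eval_nat_numeral, intro inv[of _ "insert (i - 1) P"]) simp_all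
      next
        case 2
        have gi: "greedy_inv (Suc i) 0 P"
          by (rule greedy_inv_ignore) (use 2 i(7) in auto)
        have "\<not> (reg s2 ''g'' = 1 \<and> reg s2 ''d'' = c)" using 2(2) bad r2 d by auto
        then show ?thesis
          using 2(1) d r2(1-3) c2 fr s2(1) i(1) gi
          by (cases "rdeg i = c") (simp add: g eval_nat_numeral, intro inv[of _ P], simp_all)+
      next
        case 3
        have gi: "greedy_inv (Suc i) w' P" using greedy_inv_wait i(7) 3 by simp
        show ?thesis
          using 3 d r2(1-3) c2 fr s2(1) i(1) gi
          by (cases "rdeg i = c") (simp add: g eval_nat_numeral, intro inv[of _ P], simp_all)+
      qed
    qed (use i qi f' DW in \<open>simp_all\<close>)
    moreover have "4 \<le> f'" using f' W by simp
    ultimately show "1 + test_cost ?T \<le> f' \<and> wp greedy_body I s' (f' - (1 + test_cost ?T))"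
      unfolding greedy_body_def by (simp add: eval_nat_numeral)
  next
    fix s' f' assume "I s' f'" and T: "\<not> eval_test ?T s'"
    then obtain i w P where i: "i \<le> length L"
      "\<forall>y. y \<notin> {''x'', ''d'', ''i'', ''w'', ''r'', ''g''} \<longrightarrow> reg s' y = reg s y"
      "reg s' ''i'' = i" "reg s' ''r'' = card P" "greedy_inv i w P" "f \<le> f' + 20 + i * W"
      unfolding I_def by (elim exE conjE) (rule that; assumption)
    have n: "reg s' ''n'' = length L" "reg s' ''k'' = k" using i(2) st regs by (simp_all add: graph_stored_def)
    have il: "i = length L" using T n i by simp
    have gP: "greedy P" using greedy_inv_greedy i(5) il length_Q by simp
    have "20 \<le> f'" using i(6) fW W il by simp
    then obtain g where g: "f' = g + 20" by (intro that[of "f' - 20"]) simp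
    show "1 + test_cost ?T \<le> f' \<and> wp E R s' (f' - (1 + test_cost ?T))"
      using n i(4) gP by (cases "k < card P") (auto simp: E_def R_def g eval_nat_numeral)
  qed
  have "I (s\<lparr>reg := (reg s)(''i'' := 0, ''g'' := 0, ''w'' := 0, ''r'' := 0)\<rparr>) f'" if "f \<le> f' + 20" for f'
    unfolding I_def
    by (rule exI[of _ 0], rule exI[of _ 0], rule exI[of _ "{}"])
      (use that greedy_inv_empty in simp)
  moreover have "20 \<le> f" using fW W by linarith
  then obtain g where g: "f = g + 20" by (intro that[of "f - 20"]) simp
  ultimately show ?thesis unfolding greedy_prog_def E_def[symmetric] R_def[symmetric]
    by (simp add: loop eval_nat_numeral)
qed

end

section \<open>Correctness and running time\<close>

lemma adj_in_verts:
  assumes "simple_graph G" "adj G u v" shows "u \<in> verts G" "v \<in> verts G" "u \<noteq> v"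
proof -
  obtain x y where "{u, v} = {x, y}" "x \<in> verts G" "y \<in> verts G" "x \<noteq> y"
    using assms unfolding simple_graph_def adj_def by blast
  then show "u \<in> verts G" "v \<in> verts G" "u \<noteq> v" by (auto simp: doubleton_eq_iff)
qed

lemma adj_commute: "adj G u v \<longleftrightarrow> adj G v u"
  by (simp add: adj_def insert_commute)

lemma card_clique_le:
  assumes "simple_graph G" "is_clique G K" shows "card K \<le> clique_number G"
proof -
  have "finite (verts G)" using assms by (simp add: simple_graph_def)
  then have "{card K | K. is_clique G K} \<subseteq> {..card (verts G)}"
    by (auto simp: is_clique_def card_mono)
  then have "finite {card K | K. is_clique G K}" by (rule finite_subset) simp
  then show ?thesis unfolding clique_number_def using assms(2) by (intro Max_ge) auto
qed

lemma c_closed_delete_verts: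
  assumes "S \<subseteq> verts G"
  shows "c_closed c (delete_verts G S) \<longleftrightarrow> (\<forall>u\<in>verts G - S. \<forall>v\<in>verts G - S.
    u \<noteq> v \<and> \<not> adj G u v \<longrightarrow> card {w \<in> verts G - S. adj G u w \<and> adj G v w} \<le> c - 1)"
proof -
  have a: "adj (delete_verts G S) u v \<longleftrightarrow> adj G u v" if "u \<notin> S" "v \<notin> S" for u v
    using that by (simp add: adj_def delete_verts_def)
  have v: "verts (delete_verts G S) = verts G - S" by (simp add: delete_verts_def)
  have "common_neighbors (delete_verts G S) u v = {w \<in> verts G - S. adj G u w \<and> adj G v w}"
    if "u \<notin> S" "v \<notin> S" for u v
    using a that unfolding common_neighbors_def v by blast
  then show ?thesis unfolding c_closed_def v using a by simp
qed

section \<open>Degree bounds from the clique number, and the whole program\<close>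

locale deletion_input =
  fixes G :: "nat ugraph" and L :: "nat list list" and c :: nat
  assumes c_pos: "1 \<le> c" and unit_interval_G: "unit_interval_graph G"
    and clique: "clique_number G \<le> c + 1" and lists: "adjacency_lists G L"
begin

lemma simple: "simple_graph G"
  using unit_interval_G by (simp add: unit_interval_graph_def)

lemma verts_G: "verts G = {..<length L}"
  using lists by (simp add: adjacency_lists_def)

lemma set_L: "u < length L \<Longrightarrow> set (L ! u) = {v. adj G u v}"
  using lists by (simp add: adjacency_lists_def)

lemma clique_bound: "is_clique G K \<Longrightarrow> card K \<le> c + 1"
  using card_clique_le[OF simple] clique le_trans by blast

lemma ex_unit_interval: "\<exists>a l. unit_interval {..<length L} (\<lambda>u. set (L ! u)) a l"
proof -
  obtain a :: "nat \<Rightarrow> real" and l where l: "0 < l"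
    and a: "\<forall>u\<in>verts G. \<forall>v\<in>verts G. u \<noteq> v \<longrightarrow>
      (adj G u v \<longleftrightarrow> {a u .. a u + l} \<inter> {a v .. a v + l} \<noteq> {})"
    using unit_interval_G unfolding unit_interval_graph_def by blast
  have iv: "{x .. x + l} \<inter> {y .. y + l} \<noteq> {} \<longleftrightarrow> \<bar>x - y\<bar> \<le> l" for x y :: real
  proof
    assume "\<bar>x - y\<bar> \<le> l"
    \<comment> \<open>The larger of the two left ends is a common point.\<close>
    then have "max x y \<in> {x .. x + l} \<inter> {y .. y + l}" using l by auto
    then show "{x .. x + l} \<inter> {y .. y + l} \<noteq> {}" by blast
  next
    assume "{x .. x + l} \<inter> {y .. y + l} \<noteq> {}"
    then obtain t where "t \<in> {x .. x + l} \<inter> {y .. y + l}" by blast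
    then have "x \<le> t" "t \<le> x + l" "y \<le> t" "t \<le> y + l" by simp_all
    then show "\<bar>x - y\<bar> \<le> l" by linarith
  qed
  have "unit_interval {..<length L} (\<lambda>u. set (L ! u)) a l"
  proof
    fix u assume "u \<in> {..<length L}"
    then have u: "u < length L" "u \<in> verts G" using verts_G by simp_all
    have "adj G u v \<longleftrightarrow> v \<in> verts G \<and> v \<noteq> u \<and> \<bar>a u - a v\<bar> \<le> l" for v
      using adj_in_verts[OF simple, of u v] a u(2) iv by metis
    then show "set (L ! u) = {v \<in> {..<length L}. v \<noteq> u \<and> \<bar>a u - a v\<bar> \<le> l}"
      using set_L[OF u(1)] verts_G by simp
  qed (use l in simp_all)
  then show ?thesis by blast
qed

text \<open>The neighbors on either side of \<open>u\<close> have, together with \<open>u\<close>,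
  left ends within a stretch of length \<open>l\<close>, hence form a clique. So there are at most
  \<open>c\<close> on each side.\<close>

lemma card_nb_le:
  assumes u: "u < length L" shows "card (set (L ! u)) \<le> 2 * c"
proof -
  obtain a l where ui: "unit_interval {..<length L} (\<lambda>u. set (L ! u)) a l"
    using ex_unit_interval by blast
  interpret unit_interval "{..<length L}" "\<lambda>u. set (L ! u)" a l by (rule ui)
  have cl: "card (K - {u}) \<le> c"
    if K: "K \<subseteq> {..<length L}" "u \<in> K" "\<And>v w. v \<in> K \<Longrightarrow> w \<in> K \<Longrightarrow> \<bar>a v - a w\<bar> \<le> l" for K
  proof -
    have "adj G v w" if "v \<in> K" "w \<in> K" "v \<noteq> w" for v w
    proof -
      have "w \<in> set (L ! v)" using K that in_nb[of v w] by blast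
      then show ?thesis using set_L[of v] K(1) that(1) by auto
    qed
    then have "is_clique G K" using K(1) verts_G by (simp add: is_clique_def)
    then have "card K \<le> c + 1" by (rule clique_bound)
    moreover have "finite K" using K(1) finite_subset by blast
    ultimately show ?thesis using K(2) by simp
  qed
  define R where "R = {v \<in> {..<length L}. a u \<le> a v \<and> a v \<le> a u + l}"
  define M where "M = {v \<in> {..<length L}. a v \<le> a u \<and> a u \<le> a v + l}"
  have "card (R - {u}) \<le> c" by (rule cl) (use u l_pos in \<open>auto simp: R_def\<close>)
  moreover have "card (M - {u}) \<le> c" by (rule cl) (use u l_pos in \<open>auto simp: M_def\<close>)
  moreover have "set (L ! u) \<subseteq> (R - {u}) \<union> (M - {u})"
  proof
    fix v assume "v \<in> set (L ! u)"
    then have "v < length L" "v \<noteq> u" "\<bar>a u - a v\<bar> \<le> l" using in_nb[of u v] u by auto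
    then show "v \<in> (R - {u}) \<union> (M - {u})" by (auto simp: R_def M_def)
  qed
  moreover have "finite R" "finite M" by (simp_all add: R_def M_def)
  ultimately show ?thesis
    using card_mono[of "(R - {u}) \<union> (M - {u})" "set (L ! u)"] card_Un_le[of "R - {u}" "M - {u}"]
    by simp
qed

sublocale adjacency_input L "2 * c"
proof
  fix u assume u: "u < length L"
  have sub: "set (L ! u) \<subseteq> {..<length L} - {u}"
    using set_L[OF u] adj_in_verts[OF simple] verts_G by blast
  show "w < length L" if "w \<in> set (L ! u)" for w using sub that by blast
  show d: "distinct (L ! u)" using lists u by (simp add: adjacency_lists_def)
  then show "length (L ! u) \<le> 2 * c" using card_nb_le[OF u] by (simp add: distinct_card)
  have "length (L ! u) \<le> card ({..<length L} - {u})"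
    using d card_mono[OF _ sub] by (simp add: distinct_card)
  then show "length (L ! u) < length L" using u by simp
qed

lemma adj_iff_nb: "u < length L \<Longrightarrow> adj G u v \<longleftrightarrow> v \<in> nb u"
  using set_L by (simp add: nb_def)

text \<open>A position and its right neighbors form a clique by the umbrella property, which turns
  the clique bound into the bound \<open>c\<close> on right degrees.\<close>

lemma greedy_program:
  assumes Q: "distinct Q" "set Q = {..<length L}" "umbrella nb Q"
  shows "greedy_program L (2 * c) Q c"
proof
  fix u v assume u: "u \<in> set Q" "v \<in> nb u"
  then have "adj G u v" using adj_iff_nb Q by simp
  then show "v \<in> set Q \<and> u \<in> nb v \<and> u \<noteq> v"
    using adj_in_verts[OF simple] adj_commute[of G u v] adj_iff_nb verts_G Q(2) by blast
next
  fix x assume x: "x < length Q"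
  let ?Y = "{y. x < y \<and> y < length Q \<and> Q ! y \<in> nb (Q ! x)}"
  have V: "Q ! y < length L" if "y < length Q" for y using that Q(2) nth_mem by blast
  have nn: "adj G (Q ! y) (Q ! z)" if "y \<in> insert x ?Y" "z \<in> insert x ?Y" "y < z" for y z
  proof -
    have "Q ! z \<in> nb (Q ! y)"
      using Q(3)[unfolded umbrella_def, rule_format, of x y z] that by auto
    moreover have "y < length Q" using that x by auto
    ultimately show ?thesis using adj_iff_nb V by blast
  qed
  have inj: "inj_on ((!) Q) (insert x ?Y)"
    using Q(1) x by (auto simp: inj_on_def nth_eq_iff_index_eq)
  have "is_clique G ((!) Q ` insert x ?Y)" (is "is_clique G ?K")
    unfolding is_clique_def
  proof (intro conjI ballI impI)
    show "(!) Q ` insert x ?Y \<subseteq> verts G" using V x verts_G by auto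
  next
    fix v w assume "v \<in> (!) Q ` insert x ?Y" "w \<in> (!) Q ` insert x ?Y" and ne: "v \<noteq> w"
    then obtain y z where yz: "y \<in> insert x ?Y" "z \<in> insert x ?Y" "v = Q ! y" "w = Q ! z" by blast
    then have "y < z \<or> z < y" using ne by (metis linorder_neqE_nat)
    then show "adj G v w"
      using nn[OF yz(1,2)] nn[OF yz(2,1)] yz(3,4) adj_commute by metis
  qed
  then have "card ?K \<le> c + 1" by (rule clique_bound)
  then have "card (insert x ?Y) \<le> c + 1" unfolding card_image[OF inj] .
  then show "card ?Y \<le> c" by simp
qed (use Q c_pos in simp_all)

lemma deletion_iff_closed_without:
  assumes Q: "greedy_program L (2 * c) Q c"
  shows "c_closed_vertex_deletion c G k \<longleftrightarrow>
    (\<exists>S\<subseteq>set Q. card S \<le> k \<and> umbrella_order.closed_without nb Q c S)"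
proof -
  interpret P: greedy_program L "2 * c" Q c by (rule Q)
  have V: "set Q = verts G" using P.set_Q verts_G by simp
  have "c_closed c (delete_verts G S) \<longleftrightarrow> P.closed_without S" if "S \<subseteq> verts G" for S
  proof -
    have "{w \<in> verts G - S. adj G u w \<and> adj G v w} = {w \<in> verts G - S. w \<in> nb u \<and> w \<in> nb v}"
      if "u \<in> verts G" "v \<in> verts G" for u v
      using that adj_iff_nb verts_G by auto
    then show ?thesis
      unfolding c_closed_delete_verts[OF that] P.closed_without_def V
      using adj_iff_nb verts_G by auto
  qed
  then show ?thesis unfolding c_closed_vertex_deletion_def V by blast
qed

lemma wp_deletion_prog:
  assumes f: "2000 * (length L + 1) * (2 * c + 1) \<le> f"
  shows "wp deletion_prog (\<lambda>s f. accepts s \<longleftrightarrow> c_closed_vertex_deletion c G k) (input_state c k L) f"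
proof -
  let ?R = "\<lambda>s (f :: nat). accepts s \<longleftrightarrow> c_closed_vertex_deletion c G k"
  \<comment> \<open>Hiding the product keeps the accounting linear: the parts are allowed 100, 800,
    800 and 200 times \<open>U\<close>, and the rest of the 2000 covers the assignments between
    them.\<close>
  define U where "U = (length L + 1) * (2 * c + 1)"
  have U: "1 \<le> U" by (simp add: U_def)
  have conv: "K * (length L + 1) * (2 * c + 1) = K * U" for K
    by (simp only: U_def mult.assoc)
  have fU: "2000 * U \<le> f" using f unfolding conv .
  obtain a l where "unit_interval {..<length L} (\<lambda>u. set (L ! u)) a l"
    using ex_unit_interval by blast
  moreover have "(\<lambda>u. set (L ! u)) = nb" by (simp add: nb_def fun_eq_iff)
  ultimately interpret M: unit_interval "{..<length L}" nb a l by simp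
  let ?s = "input_state c k L"
  let ?p2 = "Seq (Assign ''l'' (Reg ''j'')) (Seq (search_prog ''s'' ''t'' ''z'') greedy_prog)"
  let ?p1 = "Seq (Assign ''l'' (Reg ''n'')) (Seq (search_prog ''a'' ''s'' ''y'') ?p2)"
  have "wp degree_prog (wp ?p1 ?R) ?s f"
  proof (rule wp_degree_prog)
    show "graph_stored ?s" by (rule graph_stored_input)
    show "100 * (length L + 1) * (2 * c + 1) \<le> f" using fU unfolding conv by linarith
  next
    fix s1 :: state and f1
    assume s1: "\<And>a. a \<noteq> ''e'' \<Longrightarrow> a \<noteq> ''a'' \<Longrightarrow> arr s1 a = arr ?s a"
      "\<And>y. y \<noteq> ''x'' \<Longrightarrow> y \<noteq> ''d'' \<Longrightarrow> y \<noteq> ''u'' \<Longrightarrow> reg s1 y = reg ?s y"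
      "degrees_stored s1" "stores (arr s1 ''a'') [0..<length L]"
      "f \<le> f1 + 100 * (length L + 1) * (2 * c + 1)"
    have f1: "1900 * U \<le> f1" using fU s1(5) unfolding conv by linarith
    have r1: "reg s1 ''n'' = length L" "reg s1 ''c'' = c" "reg s1 ''k'' = k"
      using s1(2) by (simp_all add: input_state_def)
    have a1: "arr s1 ''y'' = (\<lambda>_. 0)" "arr s1 ''z'' = (\<lambda>_. 0)"
      using s1(1) by (simp_all add: input_state_def)
    have gs1: "graph_stored s1"
      by (rule graph_stored_cong[OF graph_stored_input[of c k]])
        (use s1(1,2) r1 in \<open>simp_all add: input_state_def\<close>)
    define t1 where "t1 = s1\<lparr>reg := (reg s1)(''l'' := length L)\<rparr>"
    interpret S1: search_program L "2 * c" "''a''" "''s''" "''y''" "[0..<length L]" t1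
      by unfold_locales
        (use gs1 s1(3,4) in \<open>simp_all add: t1_def graph_stored_def degrees_stored_def atLeast0LessThan\<close>)
    have "wp (search_prog ''a'' ''s'' ''y'') (wp ?p2 ?R) t1 (f1 - 2)"
    proof (rule S1.wp_search_prog)
      show "800 * (length L + 1) * (2 * c + 1) \<le> f1 - 2" using f1 U unfolding conv by linarith
    next
      fix s2 :: state and f2 Q1 fl S
      assume rep1: "S1.represents s2 (length [0..<length L], Q1, length Q1, fl, S)"
        and run1: "(search_step nb [0..<length L])\<^sup>*\<^sup>* (0, [], 0, False, [])
          (length [0..<length L], Q1, length Q1, fl, S)"
        and f2': "f1 - 2 \<le> f2 + 800 * (length L + 1) * (2 * c + 1)"
      have f2: "1050 * U \<le> f2" using f1 U f2' unfolding conv by linarith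
      have S: "set S \<subseteq> {..<length L}" "\<forall>s\<in>set S. extreme nb a s"
        "\<forall>w\<in>{..<length L}. \<exists>s\<in>set S. w \<in> reach nb s"
        by (rule M.search_starts[OF run1]; auto)+
      have a2: "arr s2 x = arr t1 x" if "x \<noteq> ''q''" "x \<noteq> ''y''" "x \<noteq> ''s''" for x
        using rep1 that unfolding S1.represents_def prod.case by blast
      have r2: "\<forall>y. y \<notin> {''i'', ''m'', ''h'', ''j'', ''f'', ''x'', ''b'', ''v''} \<longrightarrow> reg s2 y = reg t1 y"
        and st2: "stores (arr s2 ''s'') S" and j2: "reg s2 ''j'' = length S"
        and le2: "length S \<le> length [0..<length L]"
        using rep1 unfolding S1.represents_def prod.case by blast+
      define t2 where "t2 = s2\<lparr>reg := (reg s2)(''l'' := length S)\<rparr>"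
      have e: "arr t2 ''off'' = arr s1 ''off''" "arr t2 ''tgt'' = arr s1 ''tgt''"
        "arr t2 ''e'' = arr s1 ''e''" "arr t2 ''z'' = arr s1 ''z''" "arr t2 ''s'' = arr s2 ''s''"
        "reg t2 ''n'' = length L" "reg t2 ''c'' = c" "reg t2 ''k'' = k"
        "reg t2 ''l'' = length S"
        using a2 r2 r1 by (simp_all add: t1_def t2_def)
      have gs2: "graph_stored t2"
        by (rule graph_stored_cong[OF gs1]) (use e r1 in simp_all)
      interpret S2: search_program L "2 * c" "''s''" "''t''" "''z''" S t2
        by unfold_locales
          (use gs2 st2 e S(1) s1(3) in \<open>simp_all add: degrees_stored_def\<close>)
      have "wp (search_prog ''s'' ''t'' ''z'') (wp greedy_prog ?R) t2 (f2 - 2)"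
      proof (rule S2.wp_search_prog)
        show "\<forall>w<length L. arr t2 ''z'' w = 0" using e a1 by simp
        show "length S \<le> length L" using le2 by simp
        show "800 * (length L + 1) * (2 * c + 1) \<le> f2 - 2" using f2 U unfolding conv by linarith
      next
        fix s3 :: state and f3 Q fl' S'
        assume rep2: "S2.represents s3 (length S, Q, length Q, fl', S')"
          and run2: "(search_step nb S)\<^sup>*\<^sup>* (0, [], 0, False, []) (length S, Q, length Q, fl', S')"
          and f3': "f2 - 2 \<le> f3 + 800 * (length L + 1) * (2 * c + 1)"
        have f3: "200 * U \<le> f3" using f2 U f3' unfolding conv by linarith
        \<comment> \<open>The starts left by the first pass are extreme and meet every component, as
          the second pass requires.\<close>
        note Q = M.search_order[OF run2 S]
        have gp: "greedy_program L (2 * c) Q c" by (rule greedy_program[OF Q])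
        interpret P: greedy_program L "2 * c" Q c by (rule gp)
        have a3: "arr s3 x = arr t2 x" if "x \<noteq> ''q''" "x \<noteq> ''z''" "x \<noteq> ''t''" for x
          using rep2 that unfolding S2.represents_def prod.case by blast
        have r3: "\<forall>y. y \<notin> {''i'', ''m'', ''h'', ''j'', ''f'', ''x'', ''b'', ''v''} \<longrightarrow> reg s3 y = reg t2 y"
          and q3: "stores (arr s3 ''q'') Q" and z3: "positions (length L) (arr s3 ''z'') Q"
          using rep2 unfolding S2.represents_def prod.case by blast+
        have gs3: "graph_stored s3"
          by (rule graph_stored_cong[OF gs2]) (use a3 r3 in simp_all)
        have ck: "reg s3 ''c'' = c" "reg s3 ''k'' = k" using r3 e by simp_all
        have "wp greedy_prog (\<lambda>s' f'. \<exists>P. P.greedy P \<and> (reg s' ''out'' = 1 \<longleftrightarrow> card P \<le> k)) s3 f3"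
          by (rule P.wp_greedy_prog[OF gs3 ck q3 z3])
            (use f3 in \<open>simp only: conv\<close>)
        moreover have "accepts s' \<longleftrightarrow> c_closed_vertex_deletion c G k"
          if "P.greedy P" "reg s' ''out'' = 1 \<longleftrightarrow> card P \<le> k" for s' P
          using that P.greedy_optimal[OF that(1)] deletion_iff_closed_without[OF gp]
          by (simp add: accepts_def)
        ultimately show "wp greedy_prog ?R s3 f3" unfolding wp_def by blast
      qed
      moreover have "2 \<le> f2" using f2 U by simp
      ultimately show "wp ?p2 ?R s2 f2" using j2 by (simp add: t2_def eval_nat_numeral)
    qed (use a1 in \<open>simp_all add: t1_def\<close>)
    moreover have "2 \<le> f1" using f1 U by simp
    ultimately show "wp ?p1 ?R s1 f1" using r1 by (simp add: t1_def eval_nat_numeral)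
  qed
  then show ?thesis by (simp add: deletion_prog_def)
qed

end

theorem theorem6:
  "\<exists>(p :: prog) (C :: nat). \<forall>(c :: nat) (k :: nat) (G :: nat ugraph) (L :: nat list list).
     c \<ge> 1 \<and> k \<ge> 1 \<and> card (verts G) \<ge> 1 \<and>
     unit_interval_graph G \<and> clique_number G \<le> c + 1 \<and> adjacency_lists G L \<longrightarrow>
     (\<exists>t s. exec p (input_state c k L) t s \<and>
        t \<le> C * (card (verts G) * c) \<and>
        (accepts s \<longleftrightarrow> c_closed_vertex_deletion c G k))"
proof (rule exI[of _ deletion_prog], rule exI[of _ 12000], intro allI impI)
  fix c k :: nat and G :: "nat ugraph" and L :: "nat list list"
  assume *: "c \<ge> 1 \<and> k \<ge> 1 \<and> card (verts G) \<ge> 1 \<and>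
     unit_interval_graph G \<and> clique_number G \<le> c + 1 \<and> adjacency_lists G L"
  interpret deletion_input G L c by unfold_locales (use * in simp_all)
  have n: "card (verts G) = length L" using verts_G by simp
  \<comment> \<open>With at least one vertex and \<open>c\<close> positive, the two factors at most
    double and triple \<open>length L\<close> and \<open>c\<close>; this takes the constant from
    2000 to 12000.\<close>
  have "(length L + 1) * (2 * c + 1) \<le> (2 * length L) * (3 * c)"
    using * n by (intro mult_le_mono) simp_all
  then have "2000 * (length L + 1) * (2 * c + 1) \<le> 12000 * (card (verts G) * c)"
    using n by (simp add: algebra_simps)
  then show "\<exists>t s. exec deletion_prog (input_state c k L) t s \<and>
      t \<le> 12000 * (card (verts G) * c) \<and> (accepts s \<longleftrightarrow> c_closed_vertex_deletion c G k)"
    using wp_deletion_prog unfolding wp_def by blast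
qed

end
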